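(* Let $\mathcal{M}$ be a properly infinite von Neumann algebra, let $A\in\mathcal{M}^+$ and $\{B_j\}_{j=1}^N\subseteq\mathcal{M}^+$, where $N\ge1$ is an integer or $N=\infty$. The following are equivalent: (i) $A=\sum_{j=1}^N C_j$ for some $C_j\in\mathcal{M}^+$ with $C_j\sim B_j$ for all $j$. (ii) There exist mutually orthogonal projections $\{E_j\}_{j=1}^N\subseteq\mathcal{M}$ and a partial isometry $V\in\mathcal{M}$ such that $\sum_{j=1}^N E_j\ge VV^*$, $V^*V\ge R_A$, and $E_jVAV^*E_j\sim B_j$ for all $j$. If in addition $N_A\sim I$, then in (ii) we can take $V=I$.
   Context: For $B,C\in\mathcal{M}^+$, $B\sim C$ means $B=XX^*$ and $C=X^*X$ for some $X\in\mathcal{M}$; for projections this is Murray-von Neumann equivalence. $R_A$ and $N_A$ are the range projection of $A$ and the projection on the null space of $A$. Infinite sums of operators converge in the strong operator topology. *)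

theory Defs
  imports "HOL-Analysis.Analysis" "HOL-Library.Extended_Nat"
begin

(* The norm and topology are those of the underlying real inner product space, whose
   inner product is the real part of cinner; cinner is linear in its first argument. *)
class chilbert_space = real_inner + complete_space +
  fixes scaleC :: "complex \<Rightarrow> 'a \<Rightarrow> 'a" (infixr \<open>*\<^sub>C\<close> 75)
    and cinner :: "'a \<Rightarrow> 'a \<Rightarrow> complex"
  assumes scaleC_add_right: "c *\<^sub>C (x + y) = c *\<^sub>C x + c *\<^sub>C y"
    and scaleC_add_left: "(c + d) *\<^sub>C x = c *\<^sub>C x + d *\<^sub>C x"
    and scaleC_scaleC: "c *\<^sub>C (d *\<^sub>C x) = (c * d) *\<^sub>C x"
    and scaleR_scaleC: "r *\<^sub>R x = complex_of_real r *\<^sub>C x"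
    and cinner_commute: "cinner x y = cnj (cinner y x)"
    and cinner_add_left: "cinner (x + y) z = cinner x z + cinner y z"
    and cinner_scaleC_left: "cinner (c *\<^sub>C x) y = c * cinner x y"
    and inner_eq_Re_cinner: "inner x y = Re (cinner x y)"

(* Elements of this type are only real-linear; B(H) is the subset bounded_ops below. *)
type_synonym 'a op = "'a \<Rightarrow>\<^sub>L 'a"

definition bounded_ops :: "'a::chilbert_space op set" where
  "bounded_ops = {T. \<forall>c x. blinfun_apply T (c *\<^sub>C x) = c *\<^sub>C blinfun_apply T x}"

(* Well defined for T in bounded_ops, by the Riesz representation theorem. *)
definition adj :: "'a::chilbert_space op \<Rightarrow> 'a op" where
  "adj T = (THE S. \<forall>x y. cinner (blinfun_apply T x) y = cinner x (blinfun_apply S y))"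

definition positive_op :: "'a::chilbert_space op \<Rightarrow> bool" where
  "positive_op T \<longleftrightarrow> T \<in> bounded_ops \<and> adj T = T \<and> (\<forall>x. 0 \<le> Re (cinner (blinfun_apply T x) x))"

definition op_le :: "'a::chilbert_space op \<Rightarrow> 'a op \<Rightarrow> bool" (infix \<open>\<le>\<^sub>o\<^sub>p\<close> 50) where
  "S \<le>\<^sub>o\<^sub>p T \<longleftrightarrow> positive_op (T - S)"

definition projection :: "'a::chilbert_space op \<Rightarrow> bool" where
  "projection P \<longleftrightarrow> P \<in> bounded_ops \<and> adj P = P \<and> P o\<^sub>L P = P"

definition partial_isometry :: "'a::chilbert_space op \<Rightarrow> bool" where
  "partial_isometry V \<longleftrightarrow> V \<in> bounded_ops \<and> projection (adj V o\<^sub>L V)"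

(* Well defined for closed complex subspaces S. *)
definition proj_onto :: "'a::chilbert_space set \<Rightarrow> 'a op" where
  "proj_onto S = (THE P. projection P \<and> range (blinfun_apply P) = S)"

definition range_proj :: "'a::chilbert_space op \<Rightarrow> 'a op" where
  "range_proj T = proj_onto (closure (range (blinfun_apply T)))"

definition null_proj :: "'a::chilbert_space op \<Rightarrow> 'a op" where
  "null_proj T = proj_onto {x. blinfun_apply T x = 0}"

definition commutant :: "'a::chilbert_space op set \<Rightarrow> 'a op set" where
  "commutant S = {T \<in> bounded_ops. \<forall>X\<in>S. T o\<^sub>L X = X o\<^sub>L T}"

definition von_neumann_algebra :: "'a::chilbert_space op set \<Rightarrow> bool" where
  "von_neumann_algebra M \<longleftrightarrow>
     M \<subseteq> bounded_ops \<and> (\<forall>T\<in>M. adj T \<in> M) \<and> commutant (commutant M) = M"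

definition pos_part :: "'a::chilbert_space op set \<Rightarrow> 'a op set" where
  "pos_part M = {T \<in> M. positive_op T}"

definition op_equiv :: "'a::chilbert_space op set \<Rightarrow> 'a op \<Rightarrow> 'a op \<Rightarrow> bool" where
  "op_equiv M B C \<longleftrightarrow> (\<exists>X\<in>M. B = X o\<^sub>L adj X \<and> C = adj X o\<^sub>L X)"

definition finite_projection :: "'a::chilbert_space op set \<Rightarrow> 'a op \<Rightarrow> bool" where
  "finite_projection M P \<longleftrightarrow> P \<in> M \<and> projection P \<and>
     (\<forall>Q\<in>M. projection Q \<and> Q \<le>\<^sub>o\<^sub>p P \<and> op_equiv M Q P \<longrightarrow> Q = P)"

definition properly_infinite :: "'a::chilbert_space op set \<Rightarrow> bool" where
  "properly_infinite M \<longleftrightarrow>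
     (\<forall>P \<in> M \<inter> commutant M. projection P \<and> P \<noteq> 0 \<longrightarrow> \<not> finite_projection M P)"

definition index_set :: "enat \<Rightarrow> nat set" where
  "index_set N = {j. 1 \<le> j \<and> enat j \<le> N}"

(* S is the sum of the T j over 1 \<le> j \<le> N, in the strong operator topology if N = \<infinity>. *)
definition op_sums :: "enat \<Rightarrow> (nat \<Rightarrow> 'a::chilbert_space op) \<Rightarrow> 'a op \<Rightarrow> bool" where
  "op_sums N T S \<longleftrightarrow>
     (case N of enat n \<Rightarrow> S = (\<Sum>j=1..n. T j)
      | \<infinity> \<Rightarrow> \<forall>x. (\<lambda>n. \<Sum>j=1..n. blinfun_apply (T j) x) \<longlonglongrightarrow> blinfun_apply S x)"

definition sum_decomposition ::
    "'a::chilbert_space op set \<Rightarrow> enat \<Rightarrow> 'a op \<Rightarrow> (nat \<Rightarrow> 'a op) \<Rightarrow> (nat \<Rightarrow> 'a op) \<Rightarrow> bool" where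
  "sum_decomposition M N A B C \<longleftrightarrow>
     (\<forall>j\<in>index_set N. C j \<in> pos_part M \<and> op_equiv M (C j) (B j)) \<and> op_sums N C A"

definition diagonal_compression ::
    "'a::chilbert_space op set \<Rightarrow> enat \<Rightarrow> 'a op \<Rightarrow> (nat \<Rightarrow> 'a op) \<Rightarrow> (nat \<Rightarrow> 'a op) \<Rightarrow> 'a op \<Rightarrow> bool" where
  "diagonal_compression M N A B E V \<longleftrightarrow>
     (\<forall>j\<in>index_set N. E j \<in> M \<and> projection (E j)) \<and>
     (\<forall>i\<in>index_set N. \<forall>j\<in>index_set N. i \<noteq> j \<longrightarrow> E i o\<^sub>L E j = 0) \<and>
     V \<in> M \<and> partial_isometry V \<and>
     (\<exists>P. op_sums N E P \<and> V o\<^sub>L adj V \<le>\<^sub>o\<^sub>p P) \<and>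
     range_proj A \<le>\<^sub>o\<^sub>p adj V o\<^sub>L V \<and>
     (\<forall>j\<in>index_set N. op_equiv M (E j o\<^sub>L V o\<^sub>L A o\<^sub>L adj V o\<^sub>L E j) (B j))"

end

theory Submission
  imports Defs
begin

text \<open>
  If \<open>A = \<Sum> X\<^sub>j X\<^sub>j\<^sup>*\<close> with \<open>B\<^sub>j = X\<^sub>j\<^sup>* X\<^sub>j\<close>, take isometries \<open>W\<^sub>j\<close> with mutually orthogonal ranges,
  which a properly infinite algebra contains. The operator \<open>Z = \<Sum> W\<^sub>j X\<^sub>j\<^sup>*\<close> satisfies \<open>Z\<^sup>* Z = A\<close>, so
  \<open>Z = V A\<^sup>1\<^sup>/\<^sup>2\<close> for a partial isometry \<open>V\<close>, and with \<open>E\<^sub>j = W\<^sub>j W\<^sub>j\<^sup>*\<close> the compression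
  \<open>E\<^sub>j V A V\<^sup>* E\<^sub>j\<close> equals \<open>W\<^sub>j B\<^sub>j W\<^sub>j\<^sup>*\<close>. Conversely \<open>C\<^sub>j = A\<^sup>1\<^sup>/\<^sup>2 V\<^sup>* E\<^sub>j V A\<^sup>1\<^sup>/\<^sup>2\<close> is the required
  decomposition. If \<open>N\<^sub>A \<sim> I\<close>, then \<open>V\<close> extends to a unitary, because the range of the unused
  isometry \<open>W\<^sub>0\<close> makes the complement of \<open>VV\<^sup>*\<close> equivalent to \<open>I\<close>; conjugating the \<open>E\<^sub>j\<close> by it
  replaces \<open>V\<close> by \<open>I\<close>.
\<close>

text \<open>The difficulty is room. The operators B_j cannot in general be laid side by side under
  A; the isometries W_j provide one copy of the whole space for each B_j. Their existence is the
  deep ingredient: it rests on comparing projections by maximality, and since the maximal families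
  may be uncountable, sums over arbitrary index sets are developed. The terms Z_j = W_j X_j^* are
  not bounded by their index. Their sum converges strongly because the vectors Z_j x are orthogonal
  with |Z_j x|^2 = <C_j x, x>, and these numbers have partial sums at most <A x, x>. In the
  converse, C_j reaches B_j only through the compression E_j V A V^* E_j, so transitivity of the
  equivalence of positive operators has to be established on the way. Operators are only real-linear
  by type. Adjoints and projections are therefore built for the real inner product, and complex
  linearity enters as commutation with multiplication by i.\<close>

text \<open>The library's infix for composition binds weaker than addition.\<close>

notation blinfun_compose (infixl \<open>\<star>\<close> 70)

instance chilbert_space \<subseteq> banach ..

subsection \<open>Orthogonal projections and adjoints\<close>

text \<open>A minimising sequence for the distance from x to S is Cauchy by the parallelogram law,
  because midpoints stay in S. Its limit is the nearest point, and varying it along any u in S gives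
  orthogonality.\<close>

lemma orthogonal_projection_exists:
  fixes S :: "'a::{real_inner,complete_space} set"
  assumes "closed S" "subspace S"
  shows "\<exists>p\<in>S. \<forall>s\<in>S. inner (x - p) s = 0"
proof -
  define D where "D = Inf ((\<lambda>s. (norm (x - s))\<^sup>2) ` S)"
  have bdd: "bdd_below ((\<lambda>s. (norm (x - s))\<^sup>2) ` S)"
    by (rule bdd_belowI[of _ 0]) auto
  have ne: "S \<noteq> {}" using assms(2) subspace_0 by blast
  have D_le: "D \<le> (norm (x - s))\<^sup>2" if "s \<in> S" for s
    unfolding D_def using that by (intro cInf_lower bdd) auto
  have "\<exists>s\<in>S. (norm (x - s))\<^sup>2 < D + 1 / real (Suc n)" for n
    using cInf_less_iff[of "(\<lambda>s. (norm (x - s))\<^sup>2) ` S" "D + 1 / real (Suc n)"] ne bdd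
    by (auto simp: D_def)
  then obtain s where s: "\<And>n. s n \<in> S" "\<And>n. (norm (x - s n))\<^sup>2 < D + 1 / real (Suc n)"
    by metis
  have par: "(norm (s m - s n))\<^sup>2 \<le> 2 / real (Suc m) + 2 / real (Suc n)" for m n
  proof -
    have mid: "(1/2) *\<^sub>R (s m + s n) \<in> S"
      using s assms(2) by (simp add: subspace_add subspace_scale)
    have "(norm (s m - s n))\<^sup>2 = 2 * (norm (x - s m))\<^sup>2 + 2 * (norm (x - s n))\<^sup>2
        - 4 * (norm (x - (1/2) *\<^sub>R (s m + s n)))\<^sup>2"
      by (simp add: power2_norm_eq_inner algebra_simps inner_commute)
    also have "\<dots> \<le> 2 / real (Suc m) + 2 / real (Suc n)"
      using D_le[OF mid] s(2)[of m] s(2)[of n] by simp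
    finally show ?thesis .
  qed
  have "Cauchy s"
  proof (rule metric_CauchyI)
    fix e :: real assume e: "e > 0"
    \<comment> \<open>For m, n beyond n0 the bound \<open>par\<close> is at most 4 / (n0 + 1), which
      has to lie below e^2.\<close>
    then obtain n0 where n0: "1 / real (Suc n0) < e\<^sup>2 / 4"
      using nat_approx_posE[of "e\<^sup>2 / 4"] by (auto)
    have "dist (s m) (s n) < e" if "m \<ge> n0" "n \<ge> n0" for m n
    proof -
      have "1 / real (Suc m) \<le> 1 / real (Suc n0)" "1 / real (Suc n) \<le> 1 / real (Suc n0)"
        using that by (auto simp: field_simps)
      then have "(norm (s m - s n))\<^sup>2 < e\<^sup>2" using par[of m n] n0 by simp
      then show ?thesis using e by (simp add: dist_norm power2_less_imp_less)
    qed
    then show "\<exists>N. \<forall>m\<ge>N. \<forall>n\<ge>N. dist (s m) (s n) < e" by blast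
  qed
  then obtain p where p: "s \<longlonglongrightarrow> p" using Cauchy_convergent convergent_def by blast
  have pS: "p \<in> S" using assms(1) s(1) p closed_sequentially by blast
  have "(norm (x - p))\<^sup>2 \<le> D + 0"
  proof (rule LIMSEQ_le)
    show "(\<lambda>n. (norm (x - s n))\<^sup>2) \<longlonglongrightarrow> (norm (x - p))\<^sup>2" by (intro tendsto_intros p)
    show "(\<lambda>n. D + 1 / real (Suc n)) \<longlonglongrightarrow> D + 0"
      by (intro tendsto_intros LIMSEQ_Suc[OF lim_1_over_n])
  qed (use s(2) less_imp_le in blast)
  then have min: "(norm (x - p))\<^sup>2 \<le> (norm (x - s))\<^sup>2" if "s \<in> S" for s
    using D_le[OF that] by linarith
  have "inner (x - p) u = 0" if "u \<in> S" for u
  proof (cases "u = 0")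
    case False
    \<comment> \<open>This t minimises the distance from x to p + t u; the gain <x - p, u>^2 / <u,
      u> must vanish because p is already nearest.\<close>
    define t where "t = inner (x - p) u / inner u u"
    have u: "inner u u > 0" using False by simp
    have "p + t *\<^sub>R u \<in> S" using pS that assms(2) by (simp add: subspace_add subspace_scale)
    from min[OF this] have "0 \<le> - 2 * t * inner (x - p) u + t\<^sup>2 * inner u u"
      unfolding power2_norm_eq_inner by (simp add: algebra_simps inner_commute power2_eq_square)
    also have "\<dots> = - (inner (x - p) u)\<^sup>2 / inner u u"
      using u by (simp add: t_def power2_eq_square field_simps)
    finally show ?thesis using u by (simp add: divide_le_0_iff)
  qed simp
  then show ?thesis using pS by blast
qed

text \<open>The component w of some z orthogonal to the closed kernel of f spans the complement of
  that kernel, so f is a multiple of the pairing with w; evaluating at w fixes the factor.\<close>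

lemma riesz_representation_real:
  fixes f :: "'a::{real_inner,complete_space} \<Rightarrow> real"
  assumes f: "bounded_linear f"
  shows "\<exists>u. \<forall>x. f x = inner x u"
proof (cases "\<forall>x. f x = 0")
  case True
  then show ?thesis by (intro exI[of _ 0]) auto
next
  case False
  then obtain z where z: "f z \<noteq> 0" by blast
  interpret bounded_linear f by fact
  have "closed {x. f x = 0}"
    using continuous_on f by (intro closed_Collect_eq continuous_on_const linear_continuous_on)
  moreover have "subspace {x. f x = 0}" by (auto simp: subspace_def add scaleR)
  ultimately obtain p where p: "f p = 0" "\<And>s. f s = 0 \<Longrightarrow> inner (z - p) s = 0"
    using orthogonal_projection_exists[of "{x. f x = 0}" z] by auto
  define w where "w = z - p"
  have fw: "f w \<noteq> 0" using z p by (simp add: w_def diff)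
  then have w: "inner w w \<noteq> 0" by auto
  have "f x = inner x ((f w / inner w w) *\<^sub>R w)" for x
  proof -
    have "f (x - (f x / f w) *\<^sub>R w) = 0" using fw by (simp add: diff scaleR)
    then have "inner w (x - (f x / f w) *\<^sub>R w) = 0" using p(2) unfolding w_def by blast
    then have "inner x w = f x / f w * inner w w" by (simp add: inner_diff_right inner_commute)
    then show ?thesis using w fw by simp
  qed
  then show ?thesis by blast
qed

text \<open>Riesz gives S pointwise, uniqueness of the representing vector makes it linear, and |S
  x|^2 = <T (S x), x> bounds it by the norm of T.\<close>

lemma adjoint_exists_real:
  fixes T :: "'a::{real_inner,complete_space} \<Rightarrow>\<^sub>L 'a"
  shows "\<exists>S::'a \<Rightarrow>\<^sub>L 'a. \<forall>x y. inner (T x) y = inner x (S y)"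
proof -
  have "\<exists>u. \<forall>x. inner (T x) y = inner x u" for y
    by (rule riesz_representation_real) (auto intro!: bounded_linear_intros)
  then obtain S where S: "\<And>x y. inner (T x) y = inner x (S y)" by metis
  have "bounded_linear S"
  proof (rule bounded_linear_intro)
    show "S (x + y) = S x + S y" for x y
      by (metis S inner_add_right vector_eq_ldot)
    show "S (r *\<^sub>R x) = r *\<^sub>R S x" for r x
      by (metis S inner_scaleR_right vector_eq_ldot)
    show "norm (S x) \<le> norm x * norm T" for x
    proof (cases "S x = 0")
      case False
      have "norm (S x) * norm (S x) = inner (T (S x)) x"
        using S[of "S x" x] by (simp add: norm_eq_sqrt_inner)
      also have "\<dots> \<le> norm (T (S x)) * norm x"
        by (meson Cauchy_Schwarz_ineq2 abs_le_D1)
      also have "\<dots> \<le> norm T * norm (S x) * norm x"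
        by (intro mult_right_mono norm_blinfun) auto
      finally show ?thesis using False by (simp add: mult_ac)
    qed simp
  qed
  then show ?thesis using S by (intro exI[of _ "Blinfun S"]) (simp add: bounded_linear_Blinfun_apply)
qed

section \<open>Complex structure on the real Hilbert space, complex-linear operators and
  adjoints\<close>

context
  notes [simp] = scaleC_add_right scaleC_add_left scaleC_scaleC cinner_add_left cinner_scaleC_left
begin

lemma scaleC_minus_one: "(-1::complex) *\<^sub>C (x::'a::chilbert_space) = - x"
  using scaleR_scaleC[of "-1" x] by simp

lemma scaleC_zero_right [simp]: "c *\<^sub>C (0::'a::chilbert_space) = 0"
  using scaleC_add_right[of c "0::'a" 0] by simp

lemma scaleC_minus_right: "c *\<^sub>C (- x::'a::chilbert_space) = - (c *\<^sub>C x)"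
  using scaleC_add_right[of c x "-x"] by (simp del: scaleC_add_right add: eq_neg_iff_add_eq_0 add.commute)

lemma scaleC_diff_right: "c *\<^sub>C (x - y::'a::chilbert_space) = c *\<^sub>C x - c *\<^sub>C y"
  using scaleC_add_right[of c x "-y"] by (simp add: scaleC_minus_right)

lemma cinner_scaleC_right: "cinner (x::'a::chilbert_space) (c *\<^sub>C y) = cnj c * cinner x y"
  by (metis cinner_scaleC_left cinner_commute complex_cnj_mult)

text \<open>As \<open>cinner\<close> is conjugate-linear in its second argument, the imaginary part
  of <x, y> is the real part of <x, i y>. Identities for \<open>cinner\<close> thus reduce to the
  real inner product and multiplication by i.\<close>

lemma cinner_eq_inner: "cinner (x::'a::chilbert_space) y = Complex (inner x y) (inner x (\<i> *\<^sub>C y))"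
  by (simp add: complex_eq_iff inner_eq_Re_cinner cinner_scaleC_right)

lemma inner_i_left: "inner (\<i> *\<^sub>C (x::'a::chilbert_space)) y = - inner x (\<i> *\<^sub>C y)"
  by (simp add: inner_eq_Re_cinner cinner_scaleC_right)

lemma scaleC_Complex: "c *\<^sub>C (x::'a::chilbert_space) = Re c *\<^sub>R x + Im c *\<^sub>R (\<i> *\<^sub>C x)"
proof -
  have "c = complex_of_real (Re c) + complex_of_real (Im c) * \<i>"
    by (simp add: complex_eq_iff)
  then have "c *\<^sub>C x = (complex_of_real (Re c) + complex_of_real (Im c) * \<i>) *\<^sub>C x" by simp
  then show ?thesis by (simp add: scaleR_scaleC del: scaleC_scaleC add: scaleC_scaleC[symmetric])
qed

end

text \<open>Real linearity is built into the type, and every complex scalar is a real combination of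
  1 and i.\<close>

lemma bounded_ops_iff: "T \<in> bounded_ops \<longleftrightarrow> (\<forall>x. blinfun_apply T (\<i> *\<^sub>C x) = \<i> *\<^sub>C T x)"
proof
  assume "\<forall>x. blinfun_apply T (\<i> *\<^sub>C x) = \<i> *\<^sub>C T x"
  then have "blinfun_apply T (c *\<^sub>C x) = c *\<^sub>C T x" for c x
    by (simp add: scaleC_Complex[of c] blinfun.bilinear_simps)
  then show "T \<in> bounded_ops" by (simp add: bounded_ops_def)
qed (simp add: bounded_ops_def)

text \<open>The real adjoint also works for \<open>cinner\<close>, since T commutes with i.
  Uniqueness is what makes the definite description in \<open>adj\<close> meaningful.\<close>

lemma adjoint_exists:
  assumes "T \<in> bounded_ops"
  shows "\<exists>!S. \<forall>x y. cinner (blinfun_apply T x) y = cinner x (blinfun_apply S y)"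
proof -
  obtain S :: "'a op" where S: "\<And>x y. inner (T x) y = inner x (S y)"
    using adjoint_exists_real by blast
  have Ti: "T (\<i> *\<^sub>C x) = \<i> *\<^sub>C T x" for x using assms by (simp add: bounded_ops_iff)
  have "inner (T x) (\<i> *\<^sub>C y) = inner x (\<i> *\<^sub>C S y)" for x y
    using S[of "\<i> *\<^sub>C x" y] by (simp add: Ti inner_i_left)
  then have *: "cinner (T x) y = cinner x (S y)" for x y
    by (simp add: cinner_eq_inner S)
  show ?thesis
  proof (rule ex1I[of _ S])
    fix S' assume "\<forall>x y. cinner (blinfun_apply T x) y = cinner x (blinfun_apply S' y)"
    then have "inner x (S' y) = inner x (S y)" for x y
      using * by (simp add: inner_eq_Re_cinner)
    then show "S' = S" by (metis blinfun_eqI vector_eq_ldot)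
  qed (use * in blast)
qed

lemma cinner_adj: "T \<in> bounded_ops \<Longrightarrow> cinner (blinfun_apply T x) y = cinner x (adj T y)"
  using theI'[OF adjoint_exists[of T]] unfolding adj_def by blast

lemma inner_adj: "T \<in> bounded_ops \<Longrightarrow> inner (blinfun_apply T x) y = inner x (adj T y)"
  by (simp add: inner_eq_Re_cinner cinner_adj)

lemma inner_adj': "T \<in> bounded_ops \<Longrightarrow> inner x (blinfun_apply T y) = inner (adj T x) y"
  by (metis inner_adj inner_commute)

lemma adj_in_bounded_ops [simp]:
  assumes "T \<in> bounded_ops" shows "adj T \<in> bounded_ops"
proof -
  have "inner x (adj T (\<i> *\<^sub>C y)) = inner x (\<i> *\<^sub>C adj T y)" for x y
  proof -
    have "inner x (adj T (\<i> *\<^sub>C y)) = inner (T x) (\<i> *\<^sub>C y)" using assms by (simp add: inner_adj)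
    also have "\<dots> = - inner (T (\<i> *\<^sub>C x)) y" using assms by (simp add: bounded_ops_iff inner_i_left)
    also have "\<dots> = inner x (\<i> *\<^sub>C adj T y)" using assms by (simp add: inner_adj inner_i_left)
    finally show ?thesis .
  qed
  then show ?thesis unfolding bounded_ops_iff by (metis vector_eq_ldot)
qed

text \<open>Testing against the real inner product is enough, because it already separates
  vectors.\<close>

lemma adj_eqI:
  assumes "T \<in> bounded_ops" "\<And>x y. inner (blinfun_apply T x) y = inner x (blinfun_apply S y)"
  shows "adj T = S"
  using assms by (intro blinfun_eqI) (metis inner_adj vector_eq_ldot)

lemma bounded_ops_closed [simp]:
  fixes S T :: "'a::chilbert_space op"
  shows "(0::'a op) \<in> bounded_ops" "(id_blinfun::'a op) \<in> bounded_ops"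
    "S \<in> bounded_ops \<Longrightarrow> T \<in> bounded_ops \<Longrightarrow> S + T \<in> bounded_ops"
    "S \<in> bounded_ops \<Longrightarrow> T \<in> bounded_ops \<Longrightarrow> S - T \<in> bounded_ops"
    "S \<in> bounded_ops \<Longrightarrow> T \<in> bounded_ops \<Longrightarrow> S \<star> T \<in> bounded_ops"
    "S \<in> bounded_ops \<Longrightarrow> r *\<^sub>R S \<in> bounded_ops"
  by (auto simp: bounded_ops_iff blinfun.bilinear_simps scaleC_add_right scaleC_diff_right
      scaleR_scaleC scaleC_scaleC mult.commute)

lemma adj_simps [simp]:
  fixes S T :: "'a::chilbert_space op"
  shows "adj (0::'a op) = 0" "adj (id_blinfun::'a op) = id_blinfun"
    "S \<in> bounded_ops \<Longrightarrow> T \<in> bounded_ops \<Longrightarrow> adj (S + T) = adj S + adj T"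
    "S \<in> bounded_ops \<Longrightarrow> T \<in> bounded_ops \<Longrightarrow> adj (S - T) = adj S - adj T"
    "S \<in> bounded_ops \<Longrightarrow> T \<in> bounded_ops \<Longrightarrow> adj (S \<star> T) = adj T \<star> adj S"
    "S \<in> bounded_ops \<Longrightarrow> adj (r *\<^sub>R S) = r *\<^sub>R adj S"
    "S \<in> bounded_ops \<Longrightarrow> adj (adj S) = S"
proof -
  show "S \<in> bounded_ops \<Longrightarrow> adj (adj S) = S"
    by (rule adj_eqI) (simp_all add: inner_adj')
qed (rule adj_eqI; simp add: blinfun.bilinear_simps inner_adj inner_add_left inner_add_right
      inner_diff_left inner_diff_right)+

section \<open>Algebra of composition, partial isometries and the order of projections\<close>

lemma comp_assoc: "(R \<star> S) \<star> T = R \<star> (S \<star> T)"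
  by (rule blinfun_eqI) simp

lemmas comp_distribs =
  bounded_bilinear.add_left[OF bounded_bilinear_blinfun_compose]
  bounded_bilinear.add_right[OF bounded_bilinear_blinfun_compose]
  bounded_bilinear.diff_left[OF bounded_bilinear_blinfun_compose]
  bounded_bilinear.diff_right[OF bounded_bilinear_blinfun_compose]
  bounded_bilinear.minus_left[OF bounded_bilinear_blinfun_compose]
  bounded_bilinear.minus_right[OF bounded_bilinear_blinfun_compose]
  bounded_bilinear.scaleR_left[OF bounded_bilinear_blinfun_compose]
  bounded_bilinear.scaleR_right[OF bounded_bilinear_blinfun_compose]

lemma comp_simps [simp]:
  "0 \<star> T = 0" "T \<star> 0 = 0" "id_blinfun \<star> T = T" "T \<star> id_blinfun = T"
  by (auto intro: blinfun_eqI)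

lemmas op_simps = comp_assoc comp_distribs

text \<open>Products are normalised to the right by \<open>comp_assoc\<close>, so an equation for S
  T no longer matches when further factors follow. This form applies it in front of a remaining
  factor X.\<close>

lemma comp_reassoc: "S \<star> T = Q \<Longrightarrow> S \<star> (T \<star> X) = Q \<star> X"
  by (simp flip: comp_assoc)

text \<open>Here <X x, X x> = <x, X^* X x>. An operator identity can so be proved algebraically, by
  expanding X^* X for the difference X of its two sides.\<close>

lemma adj_comp_self_eq_0:
  assumes "X \<in> bounded_ops" "adj X \<star> X = 0" shows "X = 0"
proof (rule blinfun_eqI)
  fix x
  have "inner (X x) (X x) = inner x ((adj X \<star> X) x)" using assms(1) by (simp add: inner_adj)
  then show "X x = (0::'a op) x" using assms(2) by (simp only: zero_blinfun.rep_eq inner_zero_right inner_eq_zero_iff)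
qed

text \<open>With p = X^* X idempotent, (X - X p)^* (X - X p) expands to p - p - p + p = 0.\<close>

lemma partial_isometry_comp:
  assumes "X \<in> bounded_ops" "projection (adj X \<star> X)"
  shows "X \<star> (adj X \<star> X) = X"
proof -
  have p: "adj X \<star> X \<star> (adj X \<star> X) = adj X \<star> X" using assms(2) by (simp add: projection_def)
  have "X - X \<star> (adj X \<star> X) = 0"
    by (rule adj_comp_self_eq_0) (use assms(1) p in \<open>simp_all add: op_simps\<close>)
  then show ?thesis unfolding right_minus_eq by (rule sym)
qed

lemma projection_adj_comp:
  assumes "X \<in> bounded_ops" "X \<star> (adj X \<star> X) = X"
  shows "projection (adj X \<star> X)"
  using assms by (simp add: projection_def comp_assoc)

lemma projection_comp_adj:
  assumes "X \<in> bounded_ops" "X \<star> (adj X \<star> X) = X"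
  shows "projection (X \<star> adj X)"
  using assms comp_reassoc[OF assms(2), of "adj X"] by (simp add: projection_def comp_assoc)

lemma positive_comp_adj:
  assumes "X \<in> bounded_ops" shows "positive_op (X \<star> adj X)"
proof -
  have "0 \<le> inner (X (adj X x)) x" for x
    using inner_ge_zero[of "adj X x"] unfolding inner_adj[OF assms] .
  then show ?thesis using assms by (simp add: positive_op_def flip: inner_eq_Re_cinner)
qed

lemma projection_id_minus: "projection P \<Longrightarrow> projection (id_blinfun - P)"
  by (simp add: projection_def op_simps)

lemma projection_positive: "projection P \<Longrightarrow> positive_op P"
  using positive_comp_adj[of P] by (simp add: projection_def)

lemma op_le_refl: "S \<le>\<^sub>o\<^sub>p S"
  by (simp add: op_le_def positive_op_def flip: inner_eq_Re_cinner)

text \<open>For y in the range of P the inequality gives <y, y> \<le> <Q y, y>, while |y - Q y|^2 =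
  <y, y> - <Q y, y>. Hence Q fixes y; the second identity is the adjoint of the first.\<close>

lemma projection_le_imp_comp:
  assumes P: "projection P" and Q: "projection Q" and le: "P \<le>\<^sub>o\<^sub>p Q"
  shows "Q \<star> P = P" "P \<star> Q = P"
proof -
  have b: "P \<in> bounded_ops" "Q \<in> bounded_ops" "adj P = P" "adj Q = Q" "P \<star> P = P" "Q \<star> Q = Q"
    using P Q by (auto simp: projection_def)
  have PP: "P (P x) = P x" and QQ: "Q (Q x) = Q x" for x
    using b(5,6) by (metis blinfun_apply_blinfun_compose)+
  show 1: "Q \<star> P = P"
  proof (rule blinfun_eqI)
    fix x
    let ?y = "P x"
    have "0 \<le> inner ((Q - P) ?y) ?y" using le by (simp add: op_le_def positive_op_def inner_eq_Re_cinner)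
    then have "inner ?y ?y \<le> inner (Q ?y) ?y" by (simp add: blinfun.bilinear_simps inner_diff_left PP)
    moreover have "inner (Q ?y) (Q ?y) = inner (Q ?y) ?y"
      using inner_adj[OF b(2), of "?y" "Q ?y"] by (simp add: b QQ inner_commute)
    ultimately have "inner (?y - Q ?y) (?y - Q ?y) \<le> 0"
      by (simp add: inner_diff_left inner_diff_right inner_commute)
    then show "(Q \<star> P) x = P x" by (metis blinfun_apply_blinfun_compose eq_iff_diff_eq_0 inner_ge_zero inner_eq_zero_iff order_antisym)
  qed
  have "adj (Q \<star> P) = P" by (simp add: 1 b)
  then show "P \<star> Q = P" by (simp add: b)
qed

lemma projection_le_iff:
  assumes P: "projection P" and Q: "projection Q"
  shows "P \<le>\<^sub>o\<^sub>p Q \<longleftrightarrow> Q \<star> P = P"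
proof
  assume QP: "Q \<star> P = P"
  have "adj (Q \<star> P) = P" using P QP by (simp add: projection_def)
  then have "P \<star> Q = P" using P Q by (simp add: projection_def)
  then have "projection (Q - P)" using P Q QP by (simp add: projection_def op_simps)
  then show "P \<le>\<^sub>o\<^sub>p Q" by (simp add: op_le_def projection_positive)
qed (use projection_le_imp_comp[OF P Q] in simp)

section \<open>Closed complex subspaces and the projections onto them\<close>

definition closed_csubspace :: "'a::chilbert_space set \<Rightarrow> bool" where
  "closed_csubspace S \<longleftrightarrow> closed S \<and> subspace S \<and> (\<forall>x\<in>S. \<i> *\<^sub>C x \<in> S)"

text \<open>Equal ranges give Q P = P and P Q = Q, and the adjoint of the second reads Q P =
  Q.\<close>

lemma projection_eq_iff_range:
  assumes "projection P" "projection Q" "range (blinfun_apply P) = range (blinfun_apply Q)"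
  shows "P = Q"
proof -
  have *: "Q \<star> P = P" if "projection Q" and PQ: "range (blinfun_apply P) = range (blinfun_apply Q)" for P Q :: "'a op"
  proof (rule blinfun_eqI)
    fix x
    obtain y where "P x = Q y" using PQ by blast
    moreover have "Q (Q y) = Q y" using that(1) by (metis blinfun_apply_blinfun_compose projection_def)
    ultimately show "(Q \<star> P) x = P x" by simp
  qed
  have "Q = adj (P \<star> Q)" using *[where P = Q and Q = P] assms by (simp add: projection_def)
  also have "\<dots> = Q \<star> P" using assms by (simp add: projection_def)
  also have "\<dots> = P" using *[where P = P and Q = Q] assms by simp
  finally show ?thesis by simp
qed

lemma proj_onto:
  fixes S :: "'a::chilbert_space set"
  assumes "closed_csubspace S"
  shows "projection (proj_onto S)" "range (blinfun_apply (proj_onto S)) = S"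
proof -
  have cl: "closed S" "subspace S" and i: "\<And>x. x \<in> S \<Longrightarrow> \<i> *\<^sub>C x \<in> S"
    using assms by (auto simp: closed_csubspace_def)
  obtain p where p: "\<And>x. p x \<in> S" "\<And>x s. s \<in> S \<Longrightarrow> inner (x - p x) s = 0"
    using orthogonal_projection_exists[OF cl] by metis
  have pI: "p x = y" if "y \<in> S" "\<And>s. s \<in> S \<Longrightarrow> inner (x - y) s = 0" for x y
  proof -
    have "p x - y \<in> S" using p that cl by (simp add: subspace_diff)
    then have "inner (p x - y) (p x - y) = 0"
      using that(2)[of "p x - y"] p(2)[of "p x - y" x] by (simp add: algebra_simps)
    then show ?thesis by simp
  qed
  have "bounded_linear p"
  proof (rule bounded_linear_intro)
    show "p (x + y) = p x + p y" for x y
    proof (rule pI)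
      show "inner (x + y - (p x + p y)) s = 0" if "s \<in> S" for s
        using p(2)[OF that, of x] p(2)[OF that, of y] by (simp add: algebra_simps)
    qed (simp add: p cl subspace_add)
    show "p (r *\<^sub>R x) = r *\<^sub>R p x" for r x
    proof (rule pI)
      show "inner (r *\<^sub>R x - r *\<^sub>R p x) s = 0" if "s \<in> S" for s
        using p(2)[OF that, of x] by (simp flip: scaleR_diff_right)
    qed (simp add: p cl subspace_scale)
    show "norm (p x) \<le> norm x * 1" for x
    proof -
      have "inner (x - p x) (p x) = 0" using p by blast
      then have "inner x x = inner (p x) (p x) + inner (x - p x) (x - p x)"
        by (simp add: algebra_simps inner_commute)
      then have "inner (p x) (p x) \<le> inner x x" by (metis inner_ge_zero le_add_same_cancel1)
      then show ?thesis by (simp add: norm_le)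
    qed
  qed
  then have P: "blinfun_apply (Blinfun p) = p" by (simp add: bounded_linear_Blinfun_apply)
  have b: "Blinfun p \<in> bounded_ops"
    unfolding bounded_ops_iff P
  proof (intro allI pI)
    fix x s assume "s \<in> S"
    then show "inner (\<i> *\<^sub>C x - \<i> *\<^sub>C p x) s = 0"
      by (simp add: scaleC_diff_right[symmetric] inner_i_left p i)
  qed (simp add: i p)
  have pp: "p x = x" if "x \<in> S" for x by (rule pI) (use that in auto)
  have "adj (Blinfun p) = Blinfun p"
  proof (rule adj_eqI[OF b], unfold P)
    fix x y
    have "inner (p x) y = inner (p x) (p y)" using p(2)[OF p(1)[of x], of y] by (simp add: inner_commute algebra_simps)
    also have "\<dots> = inner x (p y)" using p(2)[OF p(1)[of y], of x] by (simp add: algebra_simps)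
    finally show "inner (p x) y = inner x (p y)" .
  qed
  then have proj: "projection (Blinfun p)"
    using b pp p by (auto simp: projection_def P intro!: blinfun_eqI)
  have range: "range p = S" using p pp by (metis image_subset_iff rangeI subsetI subset_antisym)
  have "\<exists>!P. projection P \<and> range (blinfun_apply P) = S"
    using proj range P projection_eq_iff_range by metis
  from theI'[OF this] show "projection (proj_onto S)" "range (blinfun_apply (proj_onto S)) = S"
    by (auto simp: proj_onto_def)
qed

lemma proj_onto_apply_eq_iff:
  assumes "closed_csubspace S"
  shows "proj_onto S x = x \<longleftrightarrow> x \<in> S"
proof
  assume "proj_onto S x = x"
  then show "x \<in> S" using proj_onto(2)[OF assms] by (metis rangeI)
next
  assume "x \<in> S"
  then obtain y where y: "x = proj_onto S y" using proj_onto(2)[OF assms] by blast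
  have "proj_onto S \<star> proj_onto S = proj_onto S" using proj_onto(1)[OF assms] by (simp add: projection_def)
  then show "proj_onto S x = x" unfolding y by (metis blinfun_apply_blinfun_compose)
qed

lemma comp_proj_onto_eqI:
  assumes "closed_csubspace S" "\<And>x. x \<in> S \<Longrightarrow> blinfun_apply T x = blinfun_apply T' x"
  shows "T \<star> proj_onto S = T' \<star> proj_onto S"
  using assms proj_onto(2)[OF assms(1)] by (intro blinfun_eqI) (metis blinfun_apply_blinfun_compose rangeI)

text \<open>Invariance under T says P T P = T P; invariance under T^*, after taking adjoints, says P
  T P = P T.\<close>

lemma proj_onto_commutes:
  assumes S: "closed_csubspace S" and T: "T \<in> bounded_ops"
    and inv: "\<And>x. x \<in> S \<Longrightarrow> blinfun_apply T x \<in> S" "\<And>x. x \<in> S \<Longrightarrow> adj T x \<in> S"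
  shows "proj_onto S \<star> T = T \<star> proj_onto S"
proof -
  let ?P = "proj_onto S"
  have P: "?P \<in> bounded_ops" "adj ?P = ?P" using proj_onto(1)[OF S] by (auto simp: projection_def)
  have *: "?P \<star> (X \<star> ?P) = X \<star> ?P" if "\<And>x. x \<in> S \<Longrightarrow> X x \<in> S" for X :: "'a op"
    using comp_proj_onto_eqI[OF S, of "?P \<star> X" X] that
    by (simp add: comp_assoc proj_onto_apply_eq_iff[OF S])
  have "adj (?P \<star> (adj T \<star> ?P)) = adj (adj T \<star> ?P)" using *[of "adj T"] inv by simp
  then have "?P \<star> (T \<star> ?P) = ?P \<star> T" using P T by (simp add: comp_assoc)
  then show ?thesis using *[of T] inv by simp
qed

lemma closed_csubspace_Collect_eq_0:
  assumes "\<And>T. T \<in> F \<Longrightarrow> T \<in> bounded_ops"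
  shows "closed_csubspace {x. \<forall>T\<in>F. blinfun_apply T x = 0}"
  unfolding closed_csubspace_def
proof (intro conjI)
  have "{x. \<forall>T\<in>F. blinfun_apply T x = 0} = (\<Inter>T\<in>F. {x. blinfun_apply T x = 0})" by auto
  then show "closed {x. \<forall>T\<in>F. blinfun_apply T x = 0}"
    by (simp, intro closed_INT ballI closed_Collect_eq continuous_intros)
  show "subspace {x. \<forall>T\<in>F. blinfun_apply T x = 0}"
    by (auto simp: subspace_def blinfun.bilinear_simps)
  show "\<forall>x\<in>{x. \<forall>T\<in>F. blinfun_apply T x = 0}. \<i> *\<^sub>C x \<in> {x. \<forall>T\<in>F. blinfun_apply T x = 0}"
    using assms by (auto simp: bounded_ops_iff)
qed

lemma closed_csubspace_kernel:
  "T \<in> bounded_ops \<Longrightarrow> closed_csubspace {x. blinfun_apply T x = 0}"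
  using closed_csubspace_Collect_eq_0[of "{T}"] by simp

lemma bounded_linear_scaleC: "bounded_linear (\<lambda>x::'a::chilbert_space. \<i> *\<^sub>C x)"
proof (rule bounded_linear_intro)
  show "norm (\<i> *\<^sub>C x) \<le> norm x * 1" for x :: 'a
  proof -
    have "inner (\<i> *\<^sub>C x) (\<i> *\<^sub>C x) = inner x x"
      by (simp add: inner_i_left scaleC_scaleC scaleC_minus_one)
    then show ?thesis by (simp add: norm_eq_sqrt_inner)
  qed
qed (simp_all add: scaleC_add_right scaleR_scaleC scaleC_scaleC mult.commute)

lemma closed_csubspace_closure_range:
  assumes "T \<in> bounded_ops"
  shows "closed_csubspace (closure (range (blinfun_apply T)))"
  unfolding closed_csubspace_def
proof (intro conjI ballI)
  let ?R = "range (blinfun_apply T)"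
  show "subspace (closure ?R)"
    unfolding subspace_def
  proof (intro conjI ballI allI)
    have "0 \<in> ?R" by (metis blinfun.zero_right rangeI)
    then show "0 \<in> closure ?R" using closure_subset[of ?R] by blast
  next
    fix x y assume "x \<in> closure ?R" "y \<in> closure ?R"
    then obtain f g where "\<And>n. f n \<in> ?R" "f \<longlonglongrightarrow> x" "\<And>n. g n \<in> ?R" "g \<longlonglongrightarrow> y"
      unfolding closure_sequential by blast
    moreover have "a + b \<in> ?R" if "a \<in> ?R" "b \<in> ?R" for a b
      using that by (auto simp flip: blinfun.add_right)
    ultimately show "x + y \<in> closure ?R"
      unfolding closure_sequential by (intro exI[of _ "\<lambda>n. f n + g n"]) (auto intro: tendsto_add)
  next
    fix x c assume "x \<in> closure ?R"
    then obtain f where "\<And>n. f n \<in> ?R" "f \<longlonglongrightarrow> x"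
      unfolding closure_sequential by blast
    moreover have "c *\<^sub>R a \<in> ?R" if "a \<in> ?R" for a
      using that by (auto simp flip: blinfun.scaleR_right)
    ultimately show "c *\<^sub>R x \<in> closure ?R"
      unfolding closure_sequential by (intro exI[of _ "\<lambda>n. c *\<^sub>R f n"]) (auto intro: tendsto_intros)
  qed
  fix x assume "x \<in> closure ?R"
  then obtain f where "\<And>n. f n \<in> ?R" "f \<longlonglongrightarrow> x"
    unfolding closure_sequential by blast
  moreover have "\<i> *\<^sub>C a \<in> ?R" if "a \<in> ?R" for a
    using that assms by (auto simp: bounded_ops_iff) (metis rangeI)
  ultimately show "\<i> *\<^sub>C x \<in> closure ?R"
    unfolding closure_sequential
    by (intro exI[of _ "\<lambda>n. \<i> *\<^sub>C f n"]) (auto intro: bounded_linear.tendsto[OF bounded_linear_scaleC])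
qed simp

lemma range_proj:
  assumes "T \<in> bounded_ops"
  shows projection_range_proj: "projection (range_proj T)"
    and range_range_proj: "range (blinfun_apply (range_proj T)) = closure (range (blinfun_apply T))"
    and range_proj_comp: "range_proj T \<star> T = T"
proof -
  note S = closed_csubspace_closure_range[OF assms]
  show "projection (range_proj T)" "range (blinfun_apply (range_proj T)) = closure (range (blinfun_apply T))"
    using proj_onto[OF S] by (auto simp: range_proj_def)
  show "range_proj T \<star> T = T"
    using proj_onto_apply_eq_iff[OF S] closure_subset[of "range (blinfun_apply T)"]
    by (intro blinfun_eqI) (auto simp: range_proj_def)
qed

text \<open>The kernel of X is closed, so it contains the closure of the range of T together with
  that range. Equations are extended in this way from T to its range projection.\<close>

lemma comp_range_proj_eq_0:
  assumes "T \<in> bounded_ops" "X \<star> T = 0"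
  shows "X \<star> range_proj T = 0"
proof -
  have "closure (range (blinfun_apply T)) \<subseteq> {x. blinfun_apply X x = 0}"
  proof (rule closure_minimal)
    show "range (blinfun_apply T) \<subseteq> {x. blinfun_apply X x = 0}"
      using assms(2) by (auto simp flip: blinfun_apply_blinfun_compose)
    show "closed {x. blinfun_apply X x = 0}" by (intro closed_Collect_eq continuous_intros)
  qed
  then have "X \<star> proj_onto (closure (range (blinfun_apply T))) = 0 \<star> proj_onto (closure (range (blinfun_apply T)))"
    by (intro comp_proj_onto_eqI closed_csubspace_closure_range assms) auto
  then show ?thesis by (simp add: range_proj_def)
qed

lemma comp_range_proj_eq:
  assumes "T \<in> bounded_ops" "X \<star> T = Y \<star> T"
  shows "X \<star> range_proj T = Y \<star> range_proj T"
  using comp_range_proj_eq_0[of T "X - Y"] assms by (simp add: op_simps)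

text \<open>For self-adjoint T the kernel is the orthogonal complement of the closed range. This
  turns the assumption on N_A into one on I - R_A.\<close>

lemma null_proj_eq:
  assumes "T \<in> bounded_ops" "adj T = T"
  shows "null_proj T = id_blinfun - range_proj T"
proof -
  let ?R = "range_proj T"
  have N: "projection (null_proj T)" "range (blinfun_apply (null_proj T)) = {x. T x = 0}"
    using proj_onto[OF closed_csubspace_kernel[OF assms(1)]] by (auto simp: null_proj_def)
  have R: "projection ?R" "adj ?R = ?R" "?R \<in> bounded_ops" using projection_range_proj[OF assms(1)] by (auto simp: projection_def)
  have TR: "T \<star> ?R = T"
  proof -
    have "adj (?R \<star> T) = T" by (simp add: range_proj_comp assms)
    then show ?thesis using assms R by simp
  qed
  have "range (blinfun_apply (id_blinfun - ?R)) = {x. T x = 0}"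
  proof (intro subset_antisym subsetI)
    fix x assume "x \<in> range (blinfun_apply (id_blinfun - ?R))"
    then obtain y where "x = (id_blinfun - ?R) y" by blast
    then have "T x = (T \<star> (id_blinfun - ?R)) y" by simp
    then show "x \<in> {x. T x = 0}" by (simp add: op_simps TR)
  next
    fix x assume "x \<in> {x. T x = 0}"
    then have Tx: "T x = 0" by simp
    have "inner (?R x) (T y) = 0" for y
    proof -
      have "inner (?R x) (T y) = inner x ((?R \<star> T) y)" using R by (simp add: inner_adj)
      also have "\<dots> = 0" using Tx inner_adj[OF assms(1), of x y] by (simp add: range_proj_comp assms)
      finally show ?thesis .
    qed
    then have "range (blinfun_apply T) \<subseteq> {z. inner (?R x) z = 0}" by auto
    then have "closure (range (blinfun_apply T)) \<subseteq> {z. inner (?R x) z = 0}"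
      by (intro closure_minimal closed_Collect_eq continuous_intros)
    then have "inner (?R x) (?R x) = 0" using range_range_proj[OF assms(1)] by blast
    then have "x = (id_blinfun - ?R) x" by (simp add: blinfun.bilinear_simps)
    then show "x \<in> range (blinfun_apply (id_blinfun - ?R))" by blast
  qed
  with N R projection_id_minus[OF R(1)] show ?thesis by (intro projection_eq_iff_range) auto
qed

subsection \<open>Closure properties of a von Neumann algebra\<close>

locale von_neumann =
  fixes M :: "'a::chilbert_space op set"
  assumes vN: "von_neumann_algebra M"
begin

lemma M_bounded [simp]: "T \<in> M \<Longrightarrow> T \<in> bounded_ops"
  using vN unfolding von_neumann_algebra_def by blast

lemma adj_in_M [simp]: "T \<in> M \<Longrightarrow> adj T \<in> M"
  using vN unfolding von_neumann_algebra_def by blast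

text \<open>The bicommutant condition as a membership test; commuting with the commutant passes to
  sums, products and strong limits.\<close>

lemma M_iff: "T \<in> M \<longleftrightarrow> T \<in> bounded_ops \<and> (\<forall>X\<in>commutant M. T \<star> X = X \<star> T)"
proof -
  have "T \<in> M \<longleftrightarrow> T \<in> commutant (commutant M)" using vN by (simp add: von_neumann_algebra_def)
  then show ?thesis by (simp add: commutant_def[of "commutant M"])
qed

lemma commutant_bounded: "X \<in> commutant M \<Longrightarrow> X \<in> bounded_ops"
  by (simp add: commutant_def)

lemma commutant_commute: "X \<in> commutant M \<Longrightarrow> T \<in> M \<Longrightarrow> X \<star> T = T \<star> X"
  by (simp add: commutant_def)

lemma adj_in_commutant:
  assumes "X \<in> commutant M" shows "adj X \<in> commutant M"
proof -
  have "adj X \<star> T = T \<star> adj X" if "T \<in> M" for T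
  proof -
    have "adj (adj T \<star> X) = adj (X \<star> adj T)" by (metis adj_in_M assms commutant_commute that)
    then show ?thesis using assms that by (simp add: commutant_bounded)
  qed
  then show ?thesis using assms by (simp add: commutant_def)
qed

lemma M_closed [simp]:
  "0 \<in> M" "id_blinfun \<in> M"
  "S \<in> M \<Longrightarrow> T \<in> M \<Longrightarrow> S + T \<in> M"
  "S \<in> M \<Longrightarrow> T \<in> M \<Longrightarrow> S - T \<in> M"
  "S \<in> M \<Longrightarrow> T \<in> M \<Longrightarrow> S \<star> T \<in> M"
  "S \<in> M \<Longrightarrow> r *\<^sub>R S \<in> M"
proof -
  show "S \<in> M \<Longrightarrow> T \<in> M \<Longrightarrow> S \<star> T \<in> M"
    unfolding M_iff by (metis bounded_ops_closed(5) comp_assoc)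
qed (simp_all add: M_iff comp_distribs)

lemma M_sum: "(\<And>i. i \<in> F \<Longrightarrow> Z i \<in> M) \<Longrightarrow> sum Z F \<in> M"
  by (induction F rule: infinite_finite_induct) auto

text \<open>Commutation with i and with each T in the commutant survives pointwise limits. The
  filter is arbitrary so that both sequences and nets of finite partial sums are covered.\<close>

lemma M_strong_limit:
  assumes lim: "\<And>x. ((\<lambda>i. blinfun_apply (f i) x) \<longlongrightarrow> blinfun_apply X x) F"
    and F: "F \<noteq> bot" and f: "\<forall>\<^sub>F i in F. f i \<in> M"
  shows "X \<in> M"
  unfolding M_iff
proof (intro conjI ballI)
  show "X \<in> bounded_ops"
    unfolding bounded_ops_iff
  proof
    fix x
    have "((\<lambda>i. \<i> *\<^sub>C f i x) \<longlongrightarrow> \<i> *\<^sub>C X x) F"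
      by (rule bounded_linear.tendsto[OF bounded_linear_scaleC lim])
    moreover have "\<forall>\<^sub>F i in F. \<i> *\<^sub>C f i x = f i (\<i> *\<^sub>C x)"
      using f by eventually_elim (metis M_bounded bounded_ops_iff)
    ultimately have "((\<lambda>i. f i (\<i> *\<^sub>C x)) \<longlongrightarrow> \<i> *\<^sub>C X x) F"
      by (rule Lim_transform_eventually)
    then show "X (\<i> *\<^sub>C x) = \<i> *\<^sub>C X x" using lim tendsto_unique[OF F] by blast
  qed
  fix T assume T: "T \<in> commutant M"
  show "X \<star> T = T \<star> X"
  proof (rule blinfun_eqI)
    fix x
    have "((\<lambda>i. T (f i x)) \<longlongrightarrow> T (X x)) F"
      by (intro blinfun.tendsto tendsto_const lim)
    moreover have "\<forall>\<^sub>F i in F. T (f i x) = f i (T x)"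
      using f by eventually_elim (metis T blinfun_apply_blinfun_compose commutant_commute)
    ultimately have "((\<lambda>i. f i (T x)) \<longlongrightarrow> T (X x)) F"
      by (rule Lim_transform_eventually)
    then show "(X \<star> T) x = (T \<star> X) x" using lim tendsto_unique[OF F] by (metis blinfun_apply_blinfun_compose)
  qed
qed

text \<open>The commutant is closed under adjoints, so a subspace invariant under it reduces each of
  its elements.\<close>

lemma proj_onto_in_M:
  assumes S: "closed_csubspace S" and inv: "\<And>T x. T \<in> commutant M \<Longrightarrow> x \<in> S \<Longrightarrow> blinfun_apply T x \<in> S"
  shows "proj_onto S \<in> M"
  unfolding M_iff
  using proj_onto(1)[OF S] proj_onto_commutes[OF S] inv
  by (auto simp: projection_def commutant_bounded adj_in_commutant)

lemma range_proj_in_M: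
  assumes "T \<in> M" shows "range_proj T \<in> M"
  unfolding range_proj_def
proof (rule proj_onto_in_M)
  show "closed_csubspace (closure (range (blinfun_apply T)))"
    using assms by (simp add: closed_csubspace_closure_range)
  fix X x assume X: "X \<in> commutant M" and x: "x \<in> closure (range (blinfun_apply T))"
  have "X (T y) = T (X y)" for y
    using commutant_commute[OF X assms] by (metis blinfun_apply_blinfun_compose)
  then have "X ` range (blinfun_apply T) \<subseteq> range (blinfun_apply T)" by auto
  then have "X ` closure (range (blinfun_apply T)) \<subseteq> closure (range (blinfun_apply T))"
    using closure_subset[of "range (blinfun_apply T)"]
    by (intro image_closure_subset continuous_intros) auto
  then show "X x \<in> closure (range (blinfun_apply T))" using x by blast
qed

end

subsection \<open>Square roots\<close>

text \<open>Positivity of A is evaluated at x - A x / K. Since <A y, y> \<le> K |y|^2 for y = A x,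
  what remains is 0 \<le> <A x, x> - |A x|^2 / K.\<close>

lemma positive_op_norm_bound:
  assumes A: "positive_op A" and K: "norm A \<le> K" "K > 0"
  shows "(norm (A x))\<^sup>2 \<le> K * inner (A x) x"
proof -
  have b: "A \<in> bounded_ops" "adj A = A" and pos: "\<And>x. 0 \<le> inner (A x) x"
    using A by (auto simp: positive_op_def inner_eq_Re_cinner)
  define y where "y = A x"
  have "inner (A y) y \<le> norm (A y) * norm y" by (rule norm_cauchy_schwarz)
  also have "\<dots> \<le> (K * norm y) * norm y"
    by (intro mult_right_mono order_trans[OF norm_blinfun] K) auto
  finally have Ay: "inner (A y) y \<le> K * inner y y" by (simp add: mult.assoc power2_norm_eq_inner flip: power2_eq_square)
  have sym: "inner (A y) x = inner y y" "inner y x = inner (A x) x"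
    using inner_adj[OF b(1), of y x] by (auto simp: b y_def)
  have "0 \<le> inner (A (x - (1/K) *\<^sub>R y)) (x - (1/K) *\<^sub>R y)" by (rule pos)
  also have "\<dots> = inner (A x) x - 2 * (1/K) * inner y y + (1/K)\<^sup>2 * inner (A y) y"
  proof -
    have "inner (A (x - t *\<^sub>R y)) (x - t *\<^sub>R y)
        = inner (A x) x - t * inner (A x) y - t * inner (A y) x + t\<^sup>2 * inner (A y) y" for t
      by (simp add: blinfun.bilinear_simps inner_diff_left inner_diff_right power2_eq_square algebra_simps)
    then show ?thesis by (simp add: sym(1) y_def[symmetric])
  qed
  also have "\<dots> \<le> inner (A x) x - 2 * (1/K) * inner y y + (1/K)\<^sup>2 * (K * inner y y)"
    using Ay by (intro add_left_mono mult_left_mono) auto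
  also have "\<dots> = inner (A x) x - inner y y / K" using K by (simp add: power2_eq_square field_simps)
  finally have "inner y y / K \<le> inner (A x) x" by simp
  then show ?thesis using K by (simp add: field_simps y_def power2_norm_eq_inner)
qed

text \<open>The square root of \<open>1 - T\<close> is \<open>1 - Y\<close> with \<open>Y = (T + Y\<^sup>2) / 2\<close>. The fixed-point iteration
  for \<open>Y\<close> is dominated in norm by the scalar iteration for \<open>T = 1\<close>, hence converges.\<close>

lemma (in von_neumann) sqrt_contraction_complement:
  assumes T: "T \<in> M" "adj T = T" "norm T \<le> 1"
  obtains D where "D \<in> M" "adj D = D" "D \<star> D = id_blinfun - T"
proof -
  define Y :: "nat \<Rightarrow> 'a op" where "Y = rec_nat 0 (\<lambda>_ Y. (1/2) *\<^sub>R (T + Y \<star> Y))"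
  define y :: "nat \<Rightarrow> real" where "y = rec_nat 0 (\<lambda>_ y. (1/2) * (1 + y * y))"
  have Y0: "Y 0 = 0" and YS: "Y (Suc n) = (1/2) *\<^sub>R (T + Y n \<star> Y n)" for n by (simp_all add: Y_def)
  have y0: "y 0 = 0" and yS: "y (Suc n) = (1/2) * (1 + y n * y n)" for n by (simp_all add: y_def)
  have YM: "Y n \<in> M \<and> adj (Y n) = Y n" for n by (induction n) (auto simp: Y0 YS T)
  have y01: "0 \<le> y n \<and> y n \<le> 1" for n
  proof (induction n)
    case (Suc n)
    then have "y n * y n \<le> 1" by (simp add: mult_le_one)
    then show ?case using Suc by (simp add: yS)
  qed (simp add: y0)
  have Yn: "norm (Y n) \<le> y n" for n
  proof (induction n)
    case (Suc n)
    have "norm (Y n \<star> Y n) \<le> y n * y n"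
      by (rule order_trans[OF norm_blinfun_compose]) (use Suc y01[of n] in \<open>simp add: mult_mono\<close>)
    then have "norm (T + Y n \<star> Y n) \<le> 1 + y n * y n" using T(3) norm_triangle_ineq[of T "Y n \<star> Y n"] by linarith
    then show ?case by (simp add: YS yS)
  qed (simp add: Y0 y0)
  have step: "norm (Y (Suc n) - Y n) \<le> y (Suc n) - y n" for n
  proof (induction n)
    case 0 then show ?case using T by (simp add: YS yS Y0 y0)
  next
    case (Suc n)
    have mono: "0 \<le> y (Suc n) - y n" using Suc norm_ge_zero order_trans by blast
    \<comment> \<open>The identity a a - b b = a (a - b) + (a - b) b holds without commutativity and
      exposes the difference bounded by the induction hypothesis.\<close>
    have "Y (Suc (Suc n)) - Y (Suc n) = (1/2) *\<^sub>R (Y (Suc n) \<star> (Y (Suc n) - Y n) + (Y (Suc n) - Y n) \<star> Y n)"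
      unfolding YS[of "Suc n"] by (subst (2) YS) (simp add: comp_distribs algebra_simps)
    then have "norm (Y (Suc (Suc n)) - Y (Suc n))
        \<le> (1/2) * (norm (Y (Suc n) \<star> (Y (Suc n) - Y n)) + norm ((Y (Suc n) - Y n) \<star> Y n))"
      by (simp add: norm_triangle_ineq)
    also have "\<dots> \<le> (1/2) * (y (Suc n) * (y (Suc n) - y n) + (y (Suc n) - y n) * y n)"
      using Suc Yn y01 mono by (intro mult_left_mono add_mono order_trans[OF norm_blinfun_compose] mult_mono)
        auto
    also have "\<dots> = y (Suc (Suc n)) - y (Suc n)"
      unfolding yS[of "Suc n"] by (subst (5) yS) (simp add: algebra_simps)
    finally show ?case .
  qed
  have diff: "norm (Y n - Y m) \<le> y n - y m" if "m \<le> n" for m n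
    using that
  proof (induction n rule: dec_induct)
    case (step k)
    then show ?case using \<open>\<And>n. norm (Y (Suc n) - Y n) \<le> y (Suc n) - y n\<close>[of k]
      norm_triangle_ineq[of "Y (Suc k) - Y k" "Y k - Y m"] by simp
  qed simp
  have "y n \<le> y (Suc n)" for n using step[of n] norm_ge_zero[of "Y (Suc n) - Y n"] by linarith
  then have "incseq y" by (rule incseq_SucI)
  moreover have "bdd_above (range y)" using y01 by (intro bdd_aboveI[of _ 1]) auto
  ultimately have "convergent y" by (metis Bseq_mono_convergent LIMSEQ_incseq_SUP convergent_def)
  then have Cy: "Cauchy y" by (rule convergent_Cauchy)
  have "Cauchy Y"
  proof (rule CauchyI)
    fix e :: real assume "e > 0"
    then obtain N where N: "\<And>m n. m \<ge> N \<Longrightarrow> n \<ge> N \<Longrightarrow> norm (y m - y n) < e" using CauchyD[OF Cy] by blast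
    have "norm (Y m - Y n) < e" if "m \<ge> N" "n \<ge> N" for m n
    proof (cases "m \<le> n")
      case True
      have "norm (Y m - Y n) \<le> y n - y m" using diff[OF True] by (simp add: norm_minus_commute)
      then show ?thesis using N[OF that(2) that(1)] by simp
    next
      case False
      then have "norm (Y m - Y n) \<le> y m - y n" using diff[of n m] by simp
      then show ?thesis using N[OF that] by simp
    qed
    then show "\<exists>N. \<forall>m\<ge>N. \<forall>n\<ge>N. norm (Y m - Y n) < e" by blast
  qed
  then obtain L where L: "Y \<longlonglongrightarrow> L" using Cauchy_convergent convergent_def by blast
  have LM: "L \<in> M"
    by (rule M_strong_limit[where f = Y and F = sequentially]) (auto intro!: blinfun.tendsto L simp: YM)
  have Ladj: "adj L = L"
  proof (rule adj_eqI)
    show "inner (L x) z = inner x (L z)" for x z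
    proof (rule LIMSEQ_unique)
      show "(\<lambda>n. inner (Y n x) z) \<longlonglongrightarrow> inner (L x) z" by (intro tendsto_intros L)
      have "inner (Y n x) z = inner x (Y n z)" for n using inner_adj[of "Y n" x z] YM[of n] by simp
      then show "(\<lambda>n. inner (Y n x) z) \<longlonglongrightarrow> inner x (L z)" by (simp, intro tendsto_intros L)
    qed
  qed (use LM in simp)
  have fp: "L = (1/2) *\<^sub>R (T + L \<star> L)"
  proof (rule LIMSEQ_unique)
    show "(\<lambda>n. Y (Suc n)) \<longlonglongrightarrow> L" using L by (rule LIMSEQ_Suc)
    show "(\<lambda>n. Y (Suc n)) \<longlonglongrightarrow> (1/2) *\<^sub>R (T + L \<star> L)"
      unfolding YS by (intro tendsto_intros bounded_bilinear.tendsto[OF bounded_bilinear_blinfun_compose] L)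
  qed
  have "2 *\<^sub>R L = 2 *\<^sub>R ((1/2) *\<^sub>R (T + L \<star> L))" using fp by simp
  then have "L + L = T + L \<star> L" by (simp add: scaleR_2)
  then have "L \<star> L = L + L - T" by (simp add: algebra_simps)
  then have "(id_blinfun - L) \<star> (id_blinfun - L) = id_blinfun - T" by (simp add: comp_distribs)
  then show thesis using that[of "id_blinfun - L"] LM Ladj by simp
qed

text \<open>Rescaling by K makes T = I - A / K a contraction, by
  \<open>positive_op_norm_bound\<close>; a root of I - T = A / K times sqrt K is a root of
  A.\<close>

lemma (in von_neumann) sqrt_exists:
  assumes A: "A \<in> pos_part M"
  obtains D where "D \<in> M" "adj D = D" "D \<star> D = A"
proof -
  have AM: "A \<in> M" and pos: "positive_op A" using A by (auto simp: pos_part_def)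
  then have adjA: "adj A = A" by (simp add: positive_op_def)
  \<comment> \<open>The summand 1 keeps K positive when A = 0.\<close>
  define K where "K = norm A + 1"
  have K: "norm A \<le> K" "K > 0" by (auto simp: K_def add_nonneg_pos)
  define T where "T = id_blinfun - (1/K) *\<^sub>R A"
  have "norm T \<le> 1"
  proof (rule norm_blinfun_bound)
    fix x
    have "(norm (T x))\<^sup>2 = (norm x)\<^sup>2 - 2 / K * inner (A x) x + (1/K)\<^sup>2 * (norm (A x))\<^sup>2"
      unfolding power2_norm_eq_inner
      by (simp add: T_def blinfun.bilinear_simps inner_diff_left inner_diff_right
          inner_commute power2_eq_square algebra_simps)
    also have "\<dots> \<le> (norm x)\<^sup>2 - 2 / K * inner (A x) x + (1/K)\<^sup>2 * (K * inner (A x) x)"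
      by (intro add_left_mono mult_left_mono positive_op_norm_bound pos K) auto
    also have "\<dots> = (norm x)\<^sup>2 - inner (A x) x / K" using K by (simp add: field_simps power2_eq_square)
    also have "\<dots> \<le> (norm x)\<^sup>2"
    proof -
      have "0 \<le> inner (A x) x" using pos by (simp add: positive_op_def inner_eq_Re_cinner)
      then show ?thesis using K by simp
    qed
    finally show "norm (T x) \<le> 1 * norm x" by (metis mult_1 norm_ge_zero power2_le_imp_le)
  qed simp
  moreover have "T \<in> M" "adj T = T" by (simp_all add: T_def AM adjA)
  ultimately obtain D where D: "D \<in> M" "adj D = D" "D \<star> D = id_blinfun - T"
    using sqrt_contraction_complement by blast
  have "(sqrt K *\<^sub>R D) \<star> (sqrt K *\<^sub>R D) = A"
    using K by (simp add: comp_distribs D T_def)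
  then show thesis using that[of "sqrt K *\<^sub>R D"] D by simp
qed

subsection \<open>Polar decomposition\<close>

text \<open>The hypothesis says |X h| = |Y h|, so Y h \<mapsto> X h is a well-defined isometry on
  the range of Y. It extends to the closure and is taken as 0 on the complement. With Y a root of
  X^* X this is polar decomposition; allowing any Y also serves to chain equivalences.\<close>

lemma (in von_neumann) partial_isometry_exists:
  assumes X: "X \<in> M" and Y: "Y \<in> M" and XY: "adj X \<star> X = adj Y \<star> Y"
  obtains U where "U \<in> M" "U \<star> Y = X" "adj U \<star> U = range_proj Y"
proof -
  define P where "P = range_proj Y"
  have P: "P \<in> M" "projection P" "P \<star> Y = Y" "range (blinfun_apply P) = closure (range (blinfun_apply Y))"
    using Y range_proj[of Y] by (auto simp: P_def range_proj_in_M)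
  have in_eq: "inner (X a) (X b) = inner (Y a) (Y b)" for a b
  proof -
    have "inner (X a) (X b) = inner a ((adj X \<star> X) b)" using X by (simp add: inner_adj)
    also have "\<dots> = inner (Y a) (Y b)" using Y by (simp add: inner_adj XY)
    finally show ?thesis .
  qed
  have norm_eq: "norm (X a - X b) = norm (Y a - Y b)" for a b
    using in_eq[of "a - b" "a - b"] by (simp add: norm_eq_sqrt_inner blinfun.bilinear_simps)
  have "\<exists>h. norm (Y h - P x) < 1 / real (Suc n)" for x n
  proof -
    have "P x \<in> closure (range (blinfun_apply Y))" using P(4) by blast
    then show ?thesis unfolding closure_approachable
      by (metis (no_types, lifting) dist_norm imageE of_nat_0_less_iff zero_less_Suc zero_less_divide_1_iff)
  qed
  \<comment> \<open>Chosen approximants: Y (h x n) tends to P x, and \<open>norm_eq\<close>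
    transfers the Cauchy property to X (h x n).\<close>
  then obtain h where h: "\<And>x n. norm (Y (h x n) - P x) < 1 / real (Suc n)" by metis
  have Yh: "(\<lambda>n. Y (h x n)) \<longlonglongrightarrow> P x" for x
  proof -
    have "(\<lambda>n. Y (h x n) - P x) \<longlonglongrightarrow> 0"
      by (rule Lim_null_comparison[OF _ LIMSEQ_Suc[OF lim_1_over_n]])
        (use h less_imp_le in \<open>auto intro!: always_eventually\<close>)
    then show ?thesis by (simp add: LIM_zero_iff)
  qed
  define u where "u x = lim (\<lambda>n. X (h x n))" for x
  have Xh: "(\<lambda>n. X (h x n)) \<longlonglongrightarrow> u x" for x
  proof -
    have "Cauchy (\<lambda>n. Y (h x n))" using Yh LIMSEQ_imp_Cauchy by blast
    then have "Cauchy (\<lambda>n. X (h x n))" by (simp add: Cauchy_iff norm_eq)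
    then show ?thesis unfolding u_def by (simp add: Cauchy_convergent convergent_LIMSEQ_iff[symmetric])
  qed
  \<comment> \<open>The limit is independent of the approximating sequence. Linearity follows
    although the choice of h is not linear.\<close>
  have u: "(\<lambda>n. X (k n)) \<longlonglongrightarrow> u x" if "(\<lambda>n. Y (k n)) \<longlonglongrightarrow> P x" for k x
  proof -
    have "(\<lambda>n. Y (k n) - Y (h x n)) \<longlonglongrightarrow> P x - P x" by (intro tendsto_diff that Yh)
    then have "(\<lambda>n. norm (X (k n) - X (h x n))) \<longlonglongrightarrow> 0" by (simp add: norm_eq tendsto_norm_zero)
    then have "(\<lambda>n. X (k n) - X (h x n)) \<longlonglongrightarrow> 0" by (rule tendsto_norm_zero_cancel)
    from tendsto_add[OF this Xh[of x]] show ?thesis by simp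
  qed
  have in_u: "inner (u x) (u y) = inner (P x) (P y)" for x y
  proof (rule LIMSEQ_unique)
    show "(\<lambda>n. inner (X (h x n)) (X (h y n))) \<longlonglongrightarrow> inner (u x) (u y)" by (intro tendsto_inner Xh)
    show "(\<lambda>n. inner (X (h x n)) (X (h y n))) \<longlonglongrightarrow> inner (P x) (P y)"
      unfolding in_eq by (intro tendsto_inner Yh)
  qed
  have "bounded_linear u"
  proof (rule bounded_linear_intro)
    fix x y r
    have "(\<lambda>n. X (h x n + h y n)) \<longlonglongrightarrow> u (x + y)"
      by (rule u) (simp add: blinfun.bilinear_simps tendsto_add Yh)
    moreover have "(\<lambda>n. X (h x n + h y n)) \<longlonglongrightarrow> u x + u y"
      by (simp add: blinfun.bilinear_simps tendsto_add Xh)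
    ultimately show "u (x + y) = u x + u y" by (rule LIMSEQ_unique)
    have "(\<lambda>n. X (r *\<^sub>R h x n)) \<longlonglongrightarrow> u (r *\<^sub>R x)"
      by (rule u) (simp add: blinfun.bilinear_simps tendsto_scaleR Yh)
    moreover have "(\<lambda>n. X (r *\<^sub>R h x n)) \<longlonglongrightarrow> r *\<^sub>R u x"
      by (simp add: blinfun.bilinear_simps tendsto_scaleR Xh)
    ultimately show "u (r *\<^sub>R x) = r *\<^sub>R u x" by (rule LIMSEQ_unique)
    show "norm (u x) \<le> norm x * norm P"
      using in_u[of x x] norm_blinfun[of P x] by (simp add: norm_eq_sqrt_inner mult.commute)
  qed
  then have U: "blinfun_apply (Blinfun u) = u" by (simp add: bounded_linear_Blinfun_apply)
  \<comment> \<open>Used for t multiplication by i, giving complex linearity, and for t in the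
    commutant, giving membership in M.\<close>
  have comm: "u (t x) = t (u x)"
    if "bounded_linear t" and t: "\<And>x. t (X x) = X (t x)" "\<And>x. t (Y x) = Y (t x)" "\<And>x. t (P x) = P (t x)" for t x
  proof (rule LIMSEQ_unique)
    have *: "f \<longlonglongrightarrow> l \<Longrightarrow> (\<lambda>n. t (f n)) \<longlonglongrightarrow> t l" for f l by (rule bounded_linear.tendsto[OF that(1)])
    show "(\<lambda>n. X (t (h x n))) \<longlonglongrightarrow> u (t x)"
      by (rule u) (use *[OF Yh[of x]] in \<open>simp add: t\<close>)
    show "(\<lambda>n. X (t (h x n))) \<longlonglongrightarrow> t (u x)" using *[OF Xh[of x]] by (simp add: t)
  qed
  have UM: "Blinfun u \<in> M"
    unfolding M_iff
  proof (intro conjI ballI)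
    have "\<i> *\<^sub>C T x = T (\<i> *\<^sub>C x)" if "T \<in> M" for T x
      using M_bounded[OF that] by (simp add: bounded_ops_iff)
    then have "u (\<i> *\<^sub>C x) = \<i> *\<^sub>C u x" for x
      using P X Y by (intro comm bounded_linear_scaleC) auto
    then show "Blinfun u \<in> bounded_ops" by (simp add: bounded_ops_iff U)
    fix T assume T: "T \<in> commutant M"
    have "T (S x) = S (T x)" if "S \<in> M" for S x
      using commutant_commute[OF T that] by (metis blinfun_apply_blinfun_compose)
    then have "u (T x) = T (u x)" for x
      using P X Y by (intro comm blinfun.bounded_linear_right) auto
    then show "Blinfun u \<star> T = T \<star> Blinfun u" by (intro blinfun_eqI) (simp add: U)
  qed
  have "Blinfun u \<star> Y = X"
  proof (rule blinfun_eqI)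
    fix z
    have "P (Y z) = Y z" using P(3) by (metis blinfun_apply_blinfun_compose)
    then have "(\<lambda>n. X z) \<longlonglongrightarrow> u (Y z)" by (intro u) simp
    then show "(Blinfun u \<star> Y) z = X z" by (simp add: U LIMSEQ_const_iff)
  qed
  moreover have "adj (Blinfun u) \<star> Blinfun u = P"
  proof (rule blinfun_eqI)
    fix x
    have "inner y ((adj (Blinfun u) \<star> Blinfun u) x) = inner y (P x)" for y
    proof -
      have "inner y ((adj (Blinfun u) \<star> Blinfun u) x) = inner (u y) (u x)"
        using inner_adj[OF M_bounded[OF UM]] by (simp add: U)
      also have "\<dots> = inner y ((adj P \<star> P) x)" using P(1) by (simp add: in_u inner_adj)
      also have "adj P \<star> P = P" using P(2) by (simp add: projection_def)
      finally show ?thesis .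
    qed
    then show "(adj (Blinfun u) \<star> Blinfun u) x = P x" by (metis vector_eq_ldot)
  qed
  ultimately show thesis using that UM by (simp add: P_def)
qed

subsection \<open>Strongly convergent orthogonal sums\<close>

lemma norm_sum_orthogonal:
  fixes f :: "'i \<Rightarrow> 'b::real_inner"
  assumes "finite F" "\<And>i j. i \<in> F \<Longrightarrow> j \<in> F \<Longrightarrow> i \<noteq> j \<Longrightarrow> inner (f i) (f j) = 0"
  shows "(norm (sum f F))\<^sup>2 = (\<Sum>i\<in>F. (norm (f i))\<^sup>2)"
  using norm_sum_Pythagorean[OF assms(1), of f] assms(2)
  by (simp add: pairwise_def orthogonal_def)

text \<open>By Pythagoras the tails of f have the same size as tails of the bounded, hence summable,
  family of squared norms. So the net of finite partial sums is Cauchy.\<close>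

lemma orthogonal_summable_on:
  fixes f :: "'i \<Rightarrow> 'b::{real_inner,complete_space}"
  assumes orth: "\<And>i j. i \<in> I \<Longrightarrow> j \<in> I \<Longrightarrow> i \<noteq> j \<Longrightarrow> inner (f i) (f j) = 0"
    and bnd: "\<And>F. finite F \<Longrightarrow> F \<subseteq> I \<Longrightarrow> (\<Sum>i\<in>F. (norm (f i))\<^sup>2) \<le> B"
  shows "f summable_on I"
proof -
  define g where "g i = (norm (f i))\<^sup>2" for i
  have "g summable_on I"
    by (rule nonneg_bdd_above_summable_on) (auto simp: g_def intro!: bdd_aboveI[of _ B] bnd)
  then obtain L where L: "(sum g \<longlongrightarrow> L) (finite_subsets_at_top I)"
    unfolding has_sum_def summable_on_def by blast
  have "\<exists>P. eventually P (finite_subsets_at_top I) \<and> (\<forall>F F'. P F \<and> P F' \<longrightarrow> dist (sum f F) (sum f F') < e)"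
    if e: "e > 0" for e
  proof -
    \<comment> \<open>Two sums of g within d of L differ by less than 2 d = (e / 2)^2; passing
      through the union of two finite sets costs e / 2 twice.\<close>
    define d where "d = e\<^sup>2 / 8"
    have "d > 0" using e by (simp add: d_def)
    then have "\<forall>\<^sub>F F in finite_subsets_at_top I. dist (sum g F) L < d" using L by (simp add: tendsto_iff)
    then obtain F0 where F0: "finite F0" "F0 \<subseteq> I"
      and close: "\<And>F. finite F \<Longrightarrow> F0 \<subseteq> F \<Longrightarrow> F \<subseteq> I \<Longrightarrow> dist (sum g F) L < d"
      unfolding eventually_finite_subsets_at_top by (elim exE conjE) simp
    have near: "dist (sum f F) (sum f F1) < e / 2"
      if F: "finite F" "F1 \<subseteq> F" "F0 \<subseteq> F1" "F \<subseteq> I" for F F1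
    proof -
      have fin: "finite F1" using F finite_subset by blast
      have "sum f F - sum f F1 = sum f (F - F1)" using F(1,2) by (simp add: sum_diff)
      moreover have "(norm (sum f (F - F1)))\<^sup>2 = sum g (F - F1)"
        unfolding g_def using F by (intro norm_sum_orthogonal orth) auto
      ultimately have "(dist (sum f F) (sum f F1))\<^sup>2 = sum g (F - F1)"
        by (simp add: dist_norm)
      also have "\<dots> = sum g F - sum g F1" using F(1,2) by (simp add: sum_diff)
      also have "\<dots> < 2 * d"
      proof -
        have "dist (sum g F) L < d" "dist (sum g F1) L < d" using F fin by (auto intro!: close)
        then show ?thesis by (simp add: dist_norm abs_less_iff)
      qed
      also have "\<dots> = (e / 2)\<^sup>2" by (simp add: d_def power2_eq_square)
      finally show ?thesis by (rule power2_less_imp_less) (use e in simp)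
    qed
    define P where "P F \<longleftrightarrow> finite F \<and> F0 \<subseteq> F \<and> F \<subseteq> I" for F
    have "dist (sum f F) (sum f F') < e" if "P F" "P F'" for F F'
      using near[of "F \<union> F'" F] near[of "F \<union> F'" F'] that
        dist_triangle3[of "sum f F" "sum f F'" "sum f (F \<union> F')"] by (auto simp: P_def)
    moreover have "eventually P (finite_subsets_at_top I)"
      unfolding eventually_finite_subsets_at_top P_def using F0 by blast
    ultimately show ?thesis by blast
  qed
  then have "cauchy_filter (filtermap (sum f) (finite_subsets_at_top I))"
    by (simp add: cauchy_filter_metric_filtermap)
  moreover have "complete (UNIV::'b set)"
    by (meson Cauchy_convergent UNIV_I complete_def convergent_def)
  ultimately obtain L' where "(sum f \<longlongrightarrow> L') (finite_subsets_at_top I)"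
    using complete_uniform[where S=UNIV] by (force simp add: filterlim_def)
  then show ?thesis using summable_on_def has_sum_def by blast
qed

text \<open>Unordered pointwise summation over an arbitrary set, as families produced by Zorn's
  lemma carry no enumeration. \<open>op_sums\<close> is its ordered counterpart over an initial
  segment of the positive integers.\<close>

definition strong_sum :: "('i \<Rightarrow> 'a::real_normed_vector \<Rightarrow>\<^sub>L 'a) \<Rightarrow> 'i set \<Rightarrow> ('a \<Rightarrow>\<^sub>L 'a) \<Rightarrow> bool" where
  "strong_sum Z I S \<longleftrightarrow> (\<forall>x. ((\<lambda>i. blinfun_apply (Z i) x) has_sum blinfun_apply S x) I)"

lemma strong_sum_unique:
  assumes "strong_sum Z I S" "strong_sum Z' I S'" "\<And>i. i \<in> I \<Longrightarrow> Z i = Z' i"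
  shows "S = S'"
proof (rule blinfun_eqI)
  fix x
  have "((\<lambda>i. blinfun_apply (Z i) x) has_sum blinfun_apply S x) I" using assms by (simp add: strong_sum_def)
  moreover have "((\<lambda>i. blinfun_apply (Z i) x) has_sum blinfun_apply S' x) I"
    using assms has_sum_cong[of I "\<lambda>i. blinfun_apply (Z i) x" "\<lambda>i. blinfun_apply (Z' i) x"]
    by (simp add: strong_sum_def)
  ultimately show "S x = S' x" by (rule has_sum_unique)
qed

lemma strong_sum_cong:
  "(\<And>i. i \<in> I \<Longrightarrow> Z i = Z' i) \<Longrightarrow> strong_sum Z I S \<longleftrightarrow> strong_sum Z' I S"
  unfolding strong_sum_def by (simp cong: has_sum_cong)

lemma strong_sum_comp_left: "strong_sum Z I S \<Longrightarrow> strong_sum (\<lambda>i. T \<star> Z i) I (T \<star> S)"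
  unfolding strong_sum_def by (auto intro!: has_sum_bounded_linear[OF blinfun.bounded_linear_right])

lemma strong_sum_comp_right: "strong_sum Z I S \<Longrightarrow> strong_sum (\<lambda>i. Z i \<star> T) I (S \<star> T)"
  unfolding strong_sum_def by auto

lemma strong_sum_0: "strong_sum (\<lambda>i. 0) I 0"
  unfolding strong_sum_def by simp

lemma strong_sum_zero:
  assumes "strong_sum Z I S" "\<And>i. i \<in> I \<Longrightarrow> Z i = 0" shows "S = 0"
  using strong_sum_unique[OF assms(1) strong_sum_0] assms(2) by simp

lemma strong_sum_single:
  assumes S: "strong_sum Z I S" and k: "k \<in> I" and 0: "\<And>i. i \<in> I \<Longrightarrow> i \<noteq> k \<Longrightarrow> Z i = 0"
  shows "S = Z k"
proof (rule blinfun_eqI)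
  fix x
  have "((\<lambda>i. Z i x) has_sum Z k x) {k}" by (simp add: has_sum_finite_iff)
  then have "((\<lambda>i. Z i x) has_sum Z k x) I"
    by (rule has_sum_cong_neutral[THEN iffD1, rotated -1]) (use k 0 in auto)
  then show "S x = Z k x" using S has_sum_unique unfolding strong_sum_def by blast
qed

lemma strong_sum_comp_eq:
  assumes "strong_sum Z I S" "\<And>i. i \<in> I \<Longrightarrow> T \<star> Z i = Z i" shows "T \<star> S = S"
  using strong_sum_unique[OF strong_sum_comp_left[OF assms(1), of T] assms(1)] assms(2) by simp

context von_neumann
begin

lemma strong_sum_in_M:
  assumes "strong_sum Z I S" "\<And>i. i \<in> I \<Longrightarrow> Z i \<in> M"
  shows "S \<in> M"
proof (rule M_strong_limit[where f = "\<lambda>F. sum Z F" and F = "finite_subsets_at_top I"])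
  show "\<forall>\<^sub>F F in finite_subsets_at_top I. sum Z F \<in> M"
    by (rule eventually_finite_subsets_at_top_weakI) (use assms(2) in \<open>auto intro!: M_sum\<close>)
qed (use assms(1) in \<open>auto simp: strong_sum_def has_sum_def blinfun.sum_left\<close>)

text \<open>Orthogonal ranges make the vectors Z_i x orthogonal and the assumed bound makes them
  summable. Mixed products vanish, so S^* Z_i = Z_i^* Z_i, and applying S^* to the sum for S gives
  the sum for S^* S.\<close>

lemma orthogonal_strong_sum:
  assumes Z: "\<And>i. i \<in> I \<Longrightarrow> Z i \<in> M"
    and orth: "\<And>i j. i \<in> I \<Longrightarrow> j \<in> I \<Longrightarrow> i \<noteq> j \<Longrightarrow> adj (Z i) \<star> Z j = 0"
    and bnd: "\<And>F x. finite F \<Longrightarrow> F \<subseteq> I \<Longrightarrow> (\<Sum>i\<in>F. (norm (Z i x))\<^sup>2) \<le> K * (norm x)\<^sup>2"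
  obtains S where "S \<in> M" "strong_sum Z I S" "strong_sum (\<lambda>i. adj (Z i) \<star> Z i) I (adj S \<star> S)"
    "\<And>k. k \<in> I \<Longrightarrow> adj (Z k) \<star> S = adj (Z k) \<star> Z k"
proof -
  have orth': "inner (Z i x) (Z j x) = 0" if "i \<in> I" "j \<in> I" "i \<noteq> j" for i j x
  proof -
    have "inner (Z i x) (Z j x) = inner x ((adj (Z i) \<star> Z j) x)" using Z[OF that(1)] by (simp add: inner_adj)
    then show ?thesis using orth[OF that] by simp
  qed
  have summ: "(\<lambda>i. Z i x) summable_on I" for x
    using orth' bnd by (rule orthogonal_summable_on)
  define s where "s x = infsum (\<lambda>i. Z i x) I" for x
  have s: "((\<lambda>i. Z i x) has_sum s x) I" for x using summ by (simp add: s_def)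
  have K: "(norm (s x))\<^sup>2 \<le> K * (norm x)\<^sup>2" for x
  proof (rule tendsto_upperbound)
    show "((\<lambda>F. (norm (\<Sum>i\<in>F. Z i x))\<^sup>2) \<longlongrightarrow> (norm (s x))\<^sup>2) (finite_subsets_at_top I)"
      using s[of x] unfolding has_sum_def by (intro tendsto_intros)
    show "\<forall>\<^sub>F F in finite_subsets_at_top I. (norm (\<Sum>i\<in>F. Z i x))\<^sup>2 \<le> K * (norm x)\<^sup>2"
    proof (rule eventually_finite_subsets_at_top_weakI)
      fix F assume F: "finite F" "F \<subseteq> I"
      then have "(norm (\<Sum>i\<in>F. Z i x))\<^sup>2 = (\<Sum>i\<in>F. (norm (Z i x))\<^sup>2)"
        by (intro norm_sum_orthogonal orth') auto
      then show "(norm (\<Sum>i\<in>F. Z i x))\<^sup>2 \<le> K * (norm x)\<^sup>2" using bnd[OF F] by simp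
    qed
  qed simp
  have "bounded_linear s"
  proof (rule bounded_linear_intro)
    fix x y r
    show "s (x + y) = s x + s y"
      using has_sum_unique[OF s[of "x + y"]] has_sum_add[OF s[of x] s[of y]] by (simp add: blinfun.bilinear_simps)
    show "s (r *\<^sub>R x) = r *\<^sub>R s x"
      using has_sum_unique[OF s[of "r *\<^sub>R x"]] has_sum_bounded_linear[OF bounded_linear_scaleR_right s[of x], of r]
      by (simp add: blinfun.bilinear_simps)
    have "norm (s x) \<le> sqrt (K * (norm x)\<^sup>2)" using real_le_rsqrt[OF K] .
    then show "norm (s x) \<le> norm x * sqrt K" by (simp add: real_sqrt_mult mult.commute)
  qed
  then have sum: "strong_sum Z I (Blinfun s)" using s by (simp add: strong_sum_def bounded_linear_Blinfun_apply)
  define S where "S = Blinfun s"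
  have S: "strong_sum Z I S" using sum by (simp add: S_def)
  have SM: "S \<in> M" using S Z by (rule strong_sum_in_M)
  have k: "adj (Z k) \<star> S = adj (Z k) \<star> Z k" if "k \<in> I" for k
    using strong_sum_single[OF strong_sum_comp_left[OF S, of "adj (Z k)"] that] orth that by metis
  have "adj S \<star> Z i = adj (Z i) \<star> Z i" if "i \<in> I" for i
  proof -
    have "adj (adj (Z i) \<star> S) = adj (adj (Z i) \<star> Z i)" using k[OF that] by simp
    then show ?thesis using Z[OF that] SM by simp
  qed
  then have "strong_sum (\<lambda>i. adj (Z i) \<star> Z i) I (adj S \<star> S)"
    using strong_sum_comp_left[OF S, of "adj S"] strong_sum_cong[of I "\<lambda>i. adj S \<star> Z i" "\<lambda>i. adj (Z i) \<star> Z i"] by simp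
  then show thesis using that S SM k by blast
qed

text \<open>Orthogonal initial spaces supply the bound with K = 1: it is Bessel's inequality for the
  components of x in those spaces.\<close>

lemma partial_isometry_strong_sum:
  assumes Z: "\<And>i. i \<in> I \<Longrightarrow> Z i \<in> M"
    and pi: "\<And>i. i \<in> I \<Longrightarrow> Z i \<star> (adj (Z i) \<star> Z i) = Z i"
    and orth: "\<And>i j. i \<in> I \<Longrightarrow> j \<in> I \<Longrightarrow> i \<noteq> j \<Longrightarrow> adj (Z i) \<star> Z j = 0"
    and orth': "\<And>i j. i \<in> I \<Longrightarrow> j \<in> I \<Longrightarrow> i \<noteq> j \<Longrightarrow> Z i \<star> adj (Z j) = 0"
  obtains S where "S \<in> M" "strong_sum Z I S" "strong_sum (\<lambda>i. adj (Z i) \<star> Z i) I (adj S \<star> S)"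
    "\<And>k. k \<in> I \<Longrightarrow> adj (Z k) \<star> S = adj (Z k) \<star> Z k" "\<And>k. k \<in> I \<Longrightarrow> S \<star> adj (Z k) = Z k \<star> adj (Z k)"
    "S \<star> (adj S \<star> S) = S"
proof -
  have bnd: "(\<Sum>i\<in>F. (norm (Z i x))\<^sup>2) \<le> 1 * (norm x)\<^sup>2" if F: "finite F" "F \<subseteq> I" for F x
  proof -
    \<comment> \<open>The component of x in the initial space of Z_i; it has the same norm as Z_i x,
      and expanding the square of x - sum p F bounds the sum.\<close>
    define p where "p i = (adj (Z i) \<star> Z i) x" for i
    have zz: "inner x (p i) = (norm (Z i x))\<^sup>2" "(norm (p i))\<^sup>2 = (norm (Z i x))\<^sup>2" if "i \<in> I" for i
    proof -
      show "inner x (p i) = (norm (Z i x))\<^sup>2" using Z[OF that] by (simp add: p_def power2_norm_eq_inner inner_adj)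
      have "(norm (p i))\<^sup>2 = inner (Z i x) ((Z i \<star> (adj (Z i) \<star> Z i)) x)"
        using Z[OF that] by (simp add: p_def power2_norm_eq_inner inner_adj')
      then show "(norm (p i))\<^sup>2 = (norm (Z i x))\<^sup>2" by (simp add: pi[OF that] power2_norm_eq_inner)
    qed
    have "inner (p i) (p j) = 0" if "i \<in> I" "j \<in> I" "i \<noteq> j" for i j
    proof -
      have "inner (p i) (p j) = inner (Z i x) ((Z i \<star> adj (Z j) \<star> Z j) x)"
        using Z that by (simp add: p_def inner_adj')
      then show ?thesis using orth'[OF that] by simp
    qed
    then have "(norm (sum p F))\<^sup>2 = (\<Sum>i\<in>F. (norm (p i))\<^sup>2)" using F by (intro norm_sum_orthogonal) auto
    also have "\<dots> = (\<Sum>i\<in>F. (norm (Z i x))\<^sup>2)" using F zz by (intro sum.cong) auto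
    finally have 1: "(norm (sum p F))\<^sup>2 = (\<Sum>i\<in>F. (norm (Z i x))\<^sup>2)" .
    have 2: "inner x (sum p F) = (\<Sum>i\<in>F. (norm (Z i x))\<^sup>2)"
      unfolding inner_sum_right using F zz by (intro sum.cong) auto
    have "0 \<le> (norm (x - sum p F))\<^sup>2" by simp
    also have "\<dots> = (norm x)\<^sup>2 - 2 * inner x (sum p F) + (norm (sum p F))\<^sup>2"
      unfolding power2_norm_eq_inner by (simp add: inner_diff_left inner_diff_right inner_commute)
    finally show ?thesis using 1 2 by simp
  qed
  obtain S where S: "S \<in> M" "strong_sum Z I S" "strong_sum (\<lambda>i. adj (Z i) \<star> Z i) I (adj S \<star> S)"
    "\<And>k. k \<in> I \<Longrightarrow> adj (Z k) \<star> S = adj (Z k) \<star> Z k"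
    using orthogonal_strong_sum[OF Z orth bnd] by blast
  have k: "S \<star> adj (Z k) = Z k \<star> adj (Z k)" if "k \<in> I" for k
    using strong_sum_single[OF strong_sum_comp_right[OF S(2), of "adj (Z k)"] that] orth' that by metis
  have "S \<star> (adj (Z i) \<star> Z i) = Z i" if "i \<in> I" for i
    using k[OF that] pi[OF that] by (metis comp_assoc)
  then have "S \<star> (adj S \<star> S) = S"
    using strong_sum_unique[OF strong_sum_comp_left[OF S(3), of S] S(2)] by simp
  then show thesis using that S k by blast
qed

lemma projection_strong_sum:
  assumes Z: "\<And>i. i \<in> I \<Longrightarrow> Z i \<in> M" and p: "\<And>i. i \<in> I \<Longrightarrow> projection (Z i)"
    and orth: "\<And>i j. i \<in> I \<Longrightarrow> j \<in> I \<Longrightarrow> i \<noteq> j \<Longrightarrow> Z i \<star> Z j = 0"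
  obtains S where "S \<in> M" "strong_sum Z I S" "projection S" "\<And>k. k \<in> I \<Longrightarrow> Z k \<star> S = Z k" "\<And>k. k \<in> I \<Longrightarrow> S \<star> Z k = Z k"
proof -
  have adjZ: "adj (Z i) = Z i" "Z i \<star> Z i = Z i" if "i \<in> I" for i using p[OF that] by (auto simp: projection_def)
  obtain S where S: "S \<in> M" "strong_sum Z I S" "strong_sum (\<lambda>i. adj (Z i) \<star> Z i) I (adj S \<star> S)"
    "\<And>k. k \<in> I \<Longrightarrow> adj (Z k) \<star> S = adj (Z k) \<star> Z k" "\<And>k. k \<in> I \<Longrightarrow> S \<star> adj (Z k) = Z k \<star> adj (Z k)"
    "S \<star> (adj S \<star> S) = S"
    by (rule partial_isometry_strong_sum[of I Z]) (use Z orth adjZ in auto)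
  have "adj S \<star> S = S"
    using strong_sum_unique[OF S(3) S(2)] by (simp add: adjZ)
  then have "projection S" using S(1,6) projection_adj_comp[of S] by simp
  with S show thesis using that by (simp add: adjZ)
qed

end

subsection \<open>Isometries with orthogonal ranges in a properly infinite algebra\<close>

text \<open>Zorn's lemma for the families of pairwise related good elements. As r need not be
  symmetric, maximality is stated for elements related to the family in both directions.\<close>

lemma maximal_pairwise_set:
  obtains F where "\<forall>x\<in>F. good x" "\<forall>x\<in>F. \<forall>y\<in>F. x \<noteq> y \<longrightarrow> r x y"
    "\<forall>x. good x \<longrightarrow> (\<forall>y\<in>F. r x y \<and> r y x) \<longrightarrow> x \<in> F"
proof -
  define \<A> where "\<A> = {F. (\<forall>x\<in>F. good x) \<and> (\<forall>x\<in>F. \<forall>y\<in>F. x \<noteq> y \<longrightarrow> r x y)}"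
  have "\<exists>F\<in>\<A>. \<forall>X\<in>\<A>. F \<subseteq> X \<longrightarrow> X = F"
  proof (rule subset_Zorn')
    fix C assume C: "subset.chain \<A> C"
    have "r x y" if "X \<in> C" "x \<in> X" "Y \<in> C" "y \<in> Y" "x \<noteq> y" for X Y x y
    proof -
      have "X \<subseteq> Y \<or> Y \<subseteq> X" using C that unfolding subset.chain_def by blast
      moreover have "X \<in> \<A>" "Y \<in> \<A>" using C that unfolding subset.chain_def by auto
      ultimately show ?thesis using that by (auto simp: \<A>_def)
    qed
    moreover have "good x" if "X \<in> C" "x \<in> X" for X x
      using C that unfolding subset.chain_def by (auto simp: \<A>_def)
    ultimately show "\<Union>C \<in> \<A>" unfolding \<A>_def by blast
  qed
  then obtain F where F: "F \<in> \<A>" and max: "\<And>X. X \<in> \<A> \<Longrightarrow> F \<subseteq> X \<Longrightarrow> X = F" by blast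
  have "x \<in> F" if "good x" "\<forall>y\<in>F. r x y \<and> r y x" for x
  proof -
    have "insert x F \<in> \<A>" using F that by (auto simp: \<A>_def)
    then show ?thesis using max[of "insert x F"] by blast
  qed
  then show thesis using that[of F] F unfolding \<A>_def by blast
qed

context von_neumann
begin

text \<open>Infinitely many mutually orthogonal projections v_n v_n^*, all equivalent to one nonzero
  F. Storing the partial isometries keeps the equivalences at hand for shifting the copies.\<close>

definition orthogonal_copies :: "(nat \<Rightarrow> 'a op) \<Rightarrow> bool" where
  "orthogonal_copies v \<longleftrightarrow> (\<forall>n. v n \<in> M) \<and>
     (\<exists>F. projection F \<and> F \<noteq> 0 \<and> (\<forall>m n. adj (v m) \<star> v n = (if m = n then F else 0)))"

lemma orthogonal_copies_partial_isometry:
  assumes "orthogonal_copies v" shows "v n \<star> (adj (v n) \<star> v n) = v n"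
proof (rule partial_isometry_comp)
  show "v n \<in> bounded_ops" "projection (adj (v n) \<star> v n)"
    using assms by (auto simp: orthogonal_copies_def)
qed

text \<open>If \<open>c\<close> is equivalent to a proper subprojection via \<open>X\<close>, the shift \<open>X\<close> moves
  the defect \<open>c - XX\<^sup>*\<close> to infinitely many orthogonal copies.\<close>

lemma orthogonal_copies_of_infinite_projection:
  assumes c: "c \<in> M" "projection c" "\<not> finite_projection M c"
  obtains v where "orthogonal_copies v" "\<And>n. c \<star> v n = v n"
proof -
  obtain Q where "Q \<in> M" "projection Q" "Q \<le>\<^sub>o\<^sub>p c" "op_equiv M Q c" "Q \<noteq> c"
    using c unfolding finite_projection_def by blast
  then obtain X where X: "X \<in> M" "Q = X \<star> adj X" "c = adj X \<star> X" unfolding op_equiv_def by blast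
  have Q: "projection Q" "Q \<le>\<^sub>o\<^sub>p c" "Q \<noteq> c" by fact+
  have cQ: "c \<star> Q = Q" "Q \<star> c = Q" using projection_le_imp_comp[OF Q(1) c(2) Q(2)] .
  have Xpi: "X \<star> (adj X \<star> X) = X" using X c by (intro partial_isometry_comp) auto
  have Xc: "X \<star> c = X" using Xpi X(3) by simp
  have QX: "Q \<star> X = X" using Xpi X(2) by (simp add: comp_assoc)
  have cX: "c \<star> X = X" by (metis QX cQ(1) comp_assoc)
  define F where "F = c - Q"
  have FM: "F \<in> M" using c X by (simp add: F_def)
  have F: "projection F" using c Q cQ by (simp add: projection_def F_def comp_distribs)
  have adjF: "adj F = F" "F \<star> F = F" using F by (auto simp: projection_def)
  have FX: "F \<star> X = 0" by (simp add: F_def comp_distribs cX QX)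
  have cF: "c \<star> F = F" using c cQ by (simp add: F_def comp_distribs projection_def)
  \<comment> \<open>So v_n = X^n F. In v_m^* v_n the common powers of X cancel; what is left is F if
    m = n, and otherwise contains F X = 0 or its adjoint.\<close>
  define v where "v = rec_nat F (\<lambda>_ Y. X \<star> Y)"
  have v0: "v 0 = F" and vS: "v (Suc n) = X \<star> v n" for n by (simp_all add: v_def)
  have vM: "v n \<in> M" for n by (induction n) (auto simp: v0 vS FM X)
  have cv: "c \<star> v n = v n" for n by (cases n) (simp_all add: v0 vS cF cX flip: comp_assoc)
  have XX: "adj X \<star> (X \<star> Y) = c \<star> Y" for Y by (simp add: X(3) comp_assoc)
  have "adj (v m) \<star> v n = (if m = n then F else 0)" for m n
  proof (induction m arbitrary: n)
    case 0
    show ?case by (cases n) (simp_all add: v0 vS adjF FX flip: comp_assoc)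
  next
    case (Suc m)
    show ?case
    proof (cases n)
      case 0
      have "adj (F \<star> X) = 0" by (simp add: FX)
      then have "adj X \<star> F = 0" using FM X by (simp add: adjF)
      then show ?thesis using 0 vM[of m] X by (simp add: v0 vS comp_assoc)
    next
      case (Suc k)
      then show ?thesis using Suc.IH[of k] vM[of m] X(1) by (simp add: vS comp_assoc XX cv)
    qed
  qed
  then have "orthogonal_copies v"
    using vM F Q(3) unfolding orthogonal_copies_def by (intro conjI exI[of _ F]) (auto simp: F_def)
  then show thesis using that cv by blast
qed

text \<open>U is the polar part of L. Its initial projection is the range projection of a root s of
  L^* L, and s Y = s because L Y = L; its range inherits D U = U from D L = L.\<close>

lemma partial_isometry_between:
  assumes L: "L \<in> M" "L \<noteq> 0" and DY: "D \<in> M" "Y \<in> M" "adj Y = Y" "D \<star> L = L" "L \<star> Y = L"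
  obtains U where "U \<in> M" "U \<noteq> 0" "U \<star> (adj U \<star> U) = U" "D \<star> U = U" "U \<star> Y = U"
proof -
  have "adj L \<star> L \<in> pos_part M"
    using L positive_comp_adj[of "adj L"] by (simp add: pos_part_def)
  then obtain s where s: "s \<in> M" "adj s = s" "s \<star> s = adj L \<star> L" by (rule sqrt_exists)
  obtain U where U: "U \<in> M" "U \<star> s = L" "adj U \<star> U = range_proj s"
    by (rule partial_isometry_exists[of L s]) (use L s in auto)
  have pi: "U \<star> (adj U \<star> U) = U"
    using U s by (intro partial_isometry_comp) (simp_all add: projection_range_proj)
  have "adj (s - s \<star> Y) \<star> (s - s \<star> Y) = adj (L - L \<star> Y) \<star> (L - L \<star> Y)"
    using s L DY(1,2,3) by (simp add: comp_distribs comp_assoc comp_reassoc[OF s(3)])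
  also have "\<dots> = 0" by (simp add: DY(5))
  finally have "s - s \<star> Y = 0" by (rule adj_comp_self_eq_0[rotated]) (simp add: s(1) DY(2))
  then have "s \<star> Y = s" unfolding right_minus_eq by (rule sym)
  then have "adj (s \<star> Y) = s" using s(2) by simp
  then have "(Y - id_blinfun) \<star> s = 0" using s DY by (simp add: comp_distribs)
  then have "(Y - id_blinfun) \<star> (adj U \<star> U) = 0" unfolding U(3) using s by (intro comp_range_proj_eq_0) auto
  then have "Y \<star> (adj U \<star> U) = adj U \<star> U" by (simp add: comp_distribs)
  then have "adj (Y \<star> (adj U \<star> U)) = adj (adj U \<star> U)" by simp
  then have "adj U \<star> U \<star> Y = adj U \<star> U" using U(1) DY by simp
  then have UY: "U \<star> Y = U" using pi by (metis comp_assoc)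
  have "(D \<star> U) \<star> s = U \<star> s" using U DY by (simp add: comp_assoc)
  then have "(D \<star> U) \<star> range_proj s = U \<star> range_proj s" using s by (intro comp_range_proj_eq) auto
  then have "D \<star> U = U" unfolding U(3)[symmetric] using pi by (simp add: comp_assoc)
  moreover have "U \<noteq> 0" using U L by auto
  ultimately show thesis using that U(1) pi UY by blast
qed

section \<open>Comparison of projections and central supports\<close>

lemma maximal_partial_isometry:
  assumes R: "R \<in> M" "projection R" and G: "G \<in> M" "projection G"
  obtains U where "U \<in> M" "U \<star> R = U" "G \<star> U = U" "U \<star> (adj U \<star> U) = U"
    "\<And>X. X \<in> M \<Longrightarrow> (R - adj U \<star> U) \<star> X \<star> (G - U \<star> adj U) = 0"
proof -
  have Rp: "R \<star> R = R" "adj R = R" "G \<star> G = G" "adj G = G" using R G by (auto simp: projection_def)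
  \<comment> \<open>Members of the family are partial isometries from parts of R to parts of G; r
    asks that their ranges and their initial spaces be orthogonal, so that they can be
    summed.\<close>
  define good where "good U \<longleftrightarrow> U \<in> M \<and> U \<noteq> 0 \<and> U \<star> (adj U \<star> U) = U \<and> G \<star> U = U \<and> U \<star> R = U" for U
  define r where "r U V \<longleftrightarrow> adj U \<star> V = 0 \<and> U \<star> adj V = 0" for U V :: "'a op"
  obtain \<Psi> where \<Psi>: "\<forall>U\<in>\<Psi>. good U" "\<forall>U\<in>\<Psi>. \<forall>V\<in>\<Psi>. U \<noteq> V \<longrightarrow> r U V"
    and max: "\<forall>U. good U \<longrightarrow> (\<forall>V\<in>\<Psi>. r U V \<and> r V U) \<longrightarrow> U \<in> \<Psi>"
    by (rule maximal_pairwise_set[of good r])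
  have good: "good U" if "U \<in> \<Psi>" for U using \<Psi> that by blast
  have r: "r U V" if "U \<in> \<Psi>" "V \<in> \<Psi>" "U \<noteq> V" for U V using \<Psi> that by blast
  obtain U where U: "U \<in> M" "strong_sum id \<Psi> U" and Uk: "\<And>V. V \<in> \<Psi> \<Longrightarrow> adj V \<star> U = adj V \<star> V" "\<And>V. V \<in> \<Psi> \<Longrightarrow> U \<star> adj V = V \<star> adj V"
    and pi: "U \<star> (adj U \<star> U) = U"
    by (rule partial_isometry_strong_sum[of \<Psi> id]) (use good r in \<open>auto simp: good_def r_def\<close>)
  have GU: "G \<star> U = U" using strong_sum_comp_eq[OF U(2), of G] good by (simp add: good_def)
  have UR: "U \<star> R = U"
    using strong_sum_unique[OF strong_sum_comp_right[OF U(2), of R] U(2)] good by (simp add: good_def)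
  have RU: "R \<star> adj U = adj U"
  proof -
    have "adj (U \<star> R) = adj U" using UR by simp
    then show ?thesis using R U Rp by simp
  qed
  have UG: "adj U \<star> G = adj U"
  proof -
    have "adj (G \<star> U) = adj U" using GU by simp
    then show ?thesis using G U Rp by simp
  qed
  define Y D where "Y = R - adj U \<star> U" and "D = G - U \<star> adj U"
  have YD: "Y \<in> M" "D \<in> M" "adj Y = Y" "adj D = D" using R G U Rp by (auto simp: Y_def D_def)
  have adjpi: "adj U \<star> (U \<star> adj U) = adj U"
  proof -
    have "adj (U \<star> (adj U \<star> U)) = adj U" using pi by simp
    then show ?thesis using U by (simp add: comp_assoc)
  qed
  have YY: "Y \<star> Y = Y"
    using comp_reassoc[OF adjpi, of U] comp_reassoc[OF RU, of U]
    by (simp add: Y_def comp_distribs comp_assoc Rp UR)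
  have DD: "D \<star> D = D"
    using comp_reassoc[OF pi, of "adj U"] comp_reassoc[OF GU, of "adj U"]
    by (simp add: D_def comp_distribs comp_assoc Rp UG)
  have VD: "adj V \<star> D = 0" and YV: "Y \<star> adj V = 0" if V: "V \<in> \<Psi>" for V
  proof -
    have g: "V \<in> M" "V \<star> (adj V \<star> V) = V" "G \<star> V = V" "V \<star> R = V" using good[OF V] by (auto simp: good_def)
    have ag: "adj V \<star> G = adj V" "R \<star> adj V = adj V"
    proof -
      have "adj (G \<star> V) = adj V" "adj (V \<star> R) = adj V" using g by simp_all
      then show "adj V \<star> G = adj V" "R \<star> adj V = adj V" using g(1) G(1) R(1) Rp by simp_all
    qed
    have "adj (U \<star> adj V) = adj (V \<star> adj V)" "adj (adj V \<star> U) = adj (adj V \<star> V)" using Uk[OF V] by simp_all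
    then have VU: "V \<star> adj U = V \<star> adj V" "adj U \<star> V = adj V \<star> V" using g(1) U(1) by simp_all
    have apiV: "adj V \<star> (V \<star> adj V) = adj V"
    proof -
      have "adj (V \<star> (adj V \<star> V)) = adj V" using g by simp
      then show ?thesis using g(1) by (simp add: comp_assoc)
    qed
    show "adj V \<star> D = 0"
      using comp_reassoc[OF Uk(1)[OF V], of "adj U"] by (simp add: D_def comp_distribs comp_assoc ag VU apiV)
    show "Y \<star> adj V = 0"
      using comp_reassoc[OF VU(2), of "adj V"] by (simp add: Y_def comp_distribs comp_assoc ag Uk(2)[OF V] apiV)
  qed
  have 0: "D \<star> (X \<star> Y) = 0" if X: "X \<in> M" for X
  proof (rule ccontr)
    assume nz: "D \<star> (X \<star> Y) \<noteq> 0"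
    obtain V where V: "V \<in> M" "V \<noteq> 0" "V \<star> (adj V \<star> V) = V" "D \<star> V = V" "V \<star> Y = V"
      by (rule partial_isometry_between[of "D \<star> (X \<star> Y)" D Y])
        (use nz X YD YY in \<open>auto simp: comp_assoc comp_reassoc[OF DD]\<close>)
    have GD: "G \<star> D = D" using comp_reassoc[OF GU, of "adj U"] by (simp add: D_def comp_distribs Rp)
    have YR: "Y \<star> R = Y" by (simp add: Y_def comp_distribs Rp comp_assoc UR)
    have gV: "good V"
      unfolding good_def using V GD YR by (metis comp_assoc)
    have "adj (D \<star> V) = adj V" "adj (V \<star> Y) = adj V" using V by simp_all
    then have aV: "adj V \<star> D = adj V" "Y \<star> adj V = adj V" using V(1) YD by simp_all
    have rWV: "r W V" if "W \<in> \<Psi>" for W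
    proof -
      have W: "W \<in> M" using good[OF that] by (simp add: good_def)
      have "adj W \<star> V = 0" by (metis V(4) VD[OF that] comp_assoc comp_simps(1))
      moreover have "adj (V \<star> adj W) = 0"
        by (metis V(5) YV[OF that] comp_assoc comp_simps(2) adj_simps(1))
      ultimately show ?thesis using V(1) W by (simp add: r_def)
    qed
    have "r V W" if "W \<in> \<Psi>" for W
    proof -
      have W: "W \<in> M" using good[OF that] by (simp add: good_def)
      have "adj (adj W \<star> V) = 0" "adj (W \<star> adj V) = 0" using rWV[OF that] by (simp_all add: r_def)
      then show ?thesis using V(1) W by (simp add: r_def)
    qed
    then have "V \<in> \<Psi>" using max gV rWV by blast
    from YV[OF this] aV(2) have "adj V = 0" by simp
    then have "adj (adj V) = 0" by simp
    then show False using V by simp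
  qed
  have "Y \<star> X \<star> D = 0" if "X \<in> M" for X
  proof -
    have "adj (D \<star> (adj X \<star> Y)) = 0" using 0[of "adj X"] that by simp
    then show ?thesis using that YD by simp
  qed
  then show thesis using that[of U] U(1) UR GU pi unfolding Y_def D_def by blast
qed

text \<open>\<open>q\<close> is the complement of the central support of \<open>Y\<close>.\<close>

lemma central_annihilator:
  assumes Y: "Y \<in> M"
  obtains q where "q \<in> M" "q \<in> commutant M" "projection q" "Y \<star> q = 0"
    "\<forall>T::'a op. (\<forall>X\<in>M. Y \<star> X \<star> T = 0) \<longrightarrow> q \<star> T = T"
proof -
  \<comment> \<open>K is invariant under M and under its commutant, hence its projection is central;
    it is the largest subspace on which all Y X vanish.\<close>
  define K where "K = {x. \<forall>T\<in>(\<lambda>X. Y \<star> X) ` M. blinfun_apply T x = 0}"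
  have Kiff: "x \<in> K \<longleftrightarrow> (\<forall>X\<in>M. Y (X x) = 0)" for x by (simp add: K_def)
  have K: "closed_csubspace K" unfolding K_def
    by (rule closed_csubspace_Collect_eq_0) (use Y in auto)
  define q where "q = proj_onto K"
  have q: "projection q" using proj_onto[OF K] by (simp add: q_def)
  have qM: "q \<in> M"
    unfolding q_def
  proof (rule proj_onto_in_M[OF K])
    fix T x assume T: "T \<in> commutant M" and x: "x \<in> K"
    have "Y (X (T x)) = T (Y (X x))" if "X \<in> M" for X
      using commutant_commute[OF T, of "Y \<star> X"] that Y by (metis M_closed(5) blinfun_apply_blinfun_compose)
    then show "T x \<in> K" using x by (simp add: Kiff blinfun.zero_right)
  qed
  have inv: "T x \<in> K" if "T \<in> M" "x \<in> K" for T x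
    using that unfolding Kiff by (metis M_closed(5) blinfun_apply_blinfun_compose)
  have "q \<star> T = T \<star> q" if "T \<in> M" for T
    unfolding q_def using that inv by (intro proj_onto_commutes K) auto
  then have qc: "q \<in> commutant M" using qM by (simp add: commutant_def)
  have "Y \<star> q = 0 \<star> q" unfolding q_def
  proof (rule comp_proj_onto_eqI[OF K])
    fix x assume "x \<in> K"
    then show "Y x = (0::'a op) x" using M_closed(2) unfolding Kiff by fastforce
  qed
  moreover have "q \<star> T = T" if T: "\<forall>X\<in>M. Y \<star> X \<star> T = 0" for T :: "'a op"
  proof (rule blinfun_eqI)
    fix x
    have "Y (X (T x)) = 0" if "X \<in> M" for X
      using T that by (metis blinfun_apply_blinfun_compose zero_blinfun.rep_eq)
    then show "(q \<star> T) x = T x" by (simp add: q_def proj_onto_apply_eq_iff[OF K] Kiff)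
  qed
  ultimately show thesis using that qM qc q by simp
qed

end

context von_neumann
begin

text \<open>S sends the n-th copy in every system to the copy with number f n at once. Injectivity
  of f keeps the ranges orthogonal, and all copies being used as initial spaces gives S^* S = G.
  This is the Hilbert hotel inside G.\<close>

lemma copies_shift:
  fixes f :: "nat \<Rightarrow> nat"
  assumes cop: "\<And>v. v \<in> \<Phi> \<Longrightarrow> orthogonal_copies v"
    and orth: "\<And>v w m n. v \<in> \<Phi> \<Longrightarrow> w \<in> \<Phi> \<Longrightarrow> v \<noteq> w \<Longrightarrow> adj (v m) \<star> w n = 0"
    and G: "strong_sum (\<lambda>(v, n). v n \<star> adj (v n)) (\<Phi> \<times> UNIV) G"
    and Gv: "\<And>v n. v \<in> \<Phi> \<Longrightarrow> G \<star> v n = v n"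
    and f: "inj f"
  obtains S where "S \<in> M" "adj S \<star> S = G" "G \<star> S = S"
    "strong_sum (\<lambda>(v, n). v (f n) \<star> adj (v n)) (\<Phi> \<times> UNIV) S"
proof -
  have vM: "v n \<in> M" if "v \<in> \<Phi>" for v n using cop[OF that] by (simp add: orthogonal_copies_def)
  have pi: "v n \<star> (adj (v n) \<star> v n) = v n" if "v \<in> \<Phi>" for v n
    by (rule orthogonal_copies_partial_isometry[OF cop[OF that]])
  have eq: "adj (v m) \<star> v m = adj (v n) \<star> v n" if "v \<in> \<Phi>" for v m n
    using cop[OF that] by (auto simp: orthogonal_copies_def)
  have ne: "adj (v m) \<star> w n = 0" if "v \<in> \<Phi>" "w \<in> \<Phi>" "(v, m) \<noteq> (w, n)" for v w m n
    using cop[OF that(1)] orth[OF that(1,2)] that(3) by (cases "v = w") (auto simp: orthogonal_copies_def)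
  have api: "adj (v n) \<star> (v n \<star> adj (v n)) = adj (v n)" if "v \<in> \<Phi>" for v n
  proof -
    have "adj (v n \<star> (adj (v n) \<star> v n)) = adj (v n)" using pi[OF that] by simp
    then show ?thesis using vM[OF that] by (simp add: comp_assoc)
  qed
  define Z where "Z = (\<lambda>(v, n). v (f n) \<star> adj (v n) :: 'a op)"
  have adjZ: "adj (Z (v, n)) = v n \<star> adj (v (f n))" if "v \<in> \<Phi>" for v n
    using vM[OF that] by (simp add: Z_def)
  have ZZ: "adj (Z (v, n)) \<star> Z (v, n) = v n \<star> adj (v n)" if "v \<in> \<Phi>" for v n
  proof -
    have "adj (Z (v, n)) \<star> Z (v, n) = v n \<star> (adj (v (f n)) \<star> v (f n)) \<star> adj (v n)"
      unfolding adjZ[OF that] by (simp add: Z_def comp_assoc)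
    also have "\<dots> = v n \<star> adj (v n)" unfolding eq[OF that, of "f n" n] by (simp add: pi[OF that])
    finally show ?thesis .
  qed
  obtain S where S: "S \<in> M" "strong_sum Z (\<Phi> \<times> UNIV) S"
    "strong_sum (\<lambda>i. adj (Z i) \<star> Z i) (\<Phi> \<times> UNIV) (adj S \<star> S)"
  proof (rule partial_isometry_strong_sum[of "\<Phi> \<times> UNIV" Z])
    fix i assume "i \<in> \<Phi> \<times> (UNIV::nat set)"
    then obtain v n where i: "i = (v, n)" "v \<in> \<Phi>" by auto
    show "Z i \<in> M" using vM i by (simp add: Z_def)
    show "Z i \<star> (adj (Z i) \<star> Z i) = Z i"
      using i by (simp add: ZZ) (simp add: Z_def comp_assoc api)
  next
    fix i j assume "i \<in> \<Phi> \<times> (UNIV::nat set)" "j \<in> \<Phi> \<times> (UNIV::nat set)" and ij: "i \<noteq> j"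
    then obtain v n w m where i: "i = (v, n)" "v \<in> \<Phi>" and j: "j = (w, m)" "w \<in> \<Phi>" by auto
    have "adj (v (f n)) \<star> w (f m) = 0" using ij i j f by (intro ne) (auto dest: injD)
    from comp_reassoc[OF this, of "adj (w m)"] show "adj (Z i) \<star> Z j = 0"
      using i j by (simp add: adjZ) (simp add: Z_def comp_assoc)
    have "adj (v n) \<star> w m = 0" using ij i j by (intro ne) auto
    from comp_reassoc[OF this, of "adj (w (f m))"] show "Z i \<star> adj (Z j) = 0"
      using i j by (simp add: adjZ) (simp add: Z_def comp_assoc)
  qed (rule that)
  have "adj S \<star> S = G"
    by (rule strong_sum_unique[OF S(3) G]) (auto simp: ZZ)
  moreover have "G \<star> S = S"
    by (rule strong_sum_comp_eq[OF S(2)]) (auto simp: Z_def Gv simp flip: comp_assoc)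
  ultimately show thesis using that S(1,2) unfolding Z_def by blast
qed

text \<open>For a maximal family of infinite systems of equivalent orthogonal projections, with sum \<open>G\<close>,
  the complement \<open>R = 1 - G\<close> contains no such system. On the central projection \<open>c\<close> where \<open>R\<close> is
  not dominated by \<open>G\<close>, all of \<open>G\<close> is equivalent to a part of \<open>R\<close>, so \<open>cG = 0\<close>; then \<open>c\<close> lies
  under \<open>R\<close> and is finite, whence \<open>c = 0\<close> and \<open>R\<close> can be absorbed into \<open>G\<close>.\<close>

lemma properly_infinite_orthogonal_isometries:
  assumes inf: "properly_infinite M"
  obtains S T where "S \<in> M" "T \<in> M" "adj S \<star> S = id_blinfun" "adj T \<star> T = id_blinfun" "adj S \<star> T = 0"
proof -
  obtain \<Phi> where \<Phi>: "\<forall>v\<in>\<Phi>. orthogonal_copies v" "\<forall>v\<in>\<Phi>. \<forall>w\<in>\<Phi>. v \<noteq> w \<longrightarrow> (\<forall>m n. adj (v m) \<star> w n = 0)"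
    and max: "\<forall>v. orthogonal_copies v \<longrightarrow> (\<forall>w\<in>\<Phi>. (\<forall>m n. adj (v m) \<star> w n = 0) \<and> (\<forall>m n. adj (w m) \<star> v n = 0)) \<longrightarrow> v \<in> \<Phi>"
    by (rule maximal_pairwise_set[of orthogonal_copies "\<lambda>v w. \<forall>m n. adj (v m) \<star> w n = 0"])
  have cop: "orthogonal_copies v" if "v \<in> \<Phi>" for v using \<Phi> that by blast
  have orth: "adj (v m) \<star> w n = 0" if "v \<in> \<Phi>" "w \<in> \<Phi>" "v \<noteq> w" for v w m n using \<Phi> that by blast
  have vM: "v n \<in> M" if "v \<in> \<Phi>" for v n using cop[OF that] by (simp add: orthogonal_copies_def)
  have max': "v \<in> \<Phi>" if v: "orthogonal_copies v" and 0: "\<And>w m n. w \<in> \<Phi> \<Longrightarrow> adj (w m) \<star> v n = 0" for v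
  proof -
    have "adj (v n) \<star> w m = 0" if "w \<in> \<Phi>" for w m n
    proof -
      have "adj (adj (w m) \<star> v n) = 0" using 0[OF that] by simp
      then show ?thesis using vM[OF that] v by (simp add: orthogonal_copies_def)
    qed
    then show ?thesis using max v 0 by blast
  qed
  have pi: "v n \<star> (adj (v n) \<star> v n) = v n" if "v \<in> \<Phi>" for v n
    by (rule orthogonal_copies_partial_isometry[OF cop[OF that]])
  have ne: "adj (v m) \<star> w n = 0" if "v \<in> \<Phi>" "w \<in> \<Phi>" "(v, m) \<noteq> (w, n)" for v w m n
    using cop[OF that(1)] orth[OF that(1,2)] that(3) by (cases "v = w") (auto simp: orthogonal_copies_def)
  define e where "e = (\<lambda>(v, n). v n \<star> adj (v (n::nat)) :: 'a op)"
  obtain G where GM: "G \<in> M" and Gsum: "strong_sum e (\<Phi> \<times> UNIV) G" and Gp: "projection G"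
    and Ge: "\<And>i. i \<in> \<Phi> \<times> UNIV \<Longrightarrow> G \<star> e i = e i"
  proof (rule projection_strong_sum[of "\<Phi> \<times> UNIV" e])
    fix i assume "i \<in> \<Phi> \<times> (UNIV::nat set)"
    then obtain v n where i: "i = (v, n)" "v \<in> \<Phi>" by auto
    show "e i \<in> M" using vM i by (simp add: e_def)
    show "projection (e i)" using i vM pi by (simp add: e_def projection_comp_adj)
  next
    fix i j assume "i \<in> \<Phi> \<times> (UNIV::nat set)" "j \<in> \<Phi> \<times> (UNIV::nat set)" and ij: "i \<noteq> j"
    then obtain v n w m where i: "i = (v, n)" "v \<in> \<Phi>" and j: "j = (w, m)" "w \<in> \<Phi>" by auto
    have "adj (v n) \<star> w m = 0" using ij i j by (intro ne) auto
    from comp_reassoc[OF this, of "adj (w m)"] show "e i \<star> e j = 0"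
      using i j by (simp add: e_def comp_assoc)
  qed (rule that)
  have Gv: "G \<star> v n = v n" if "v \<in> \<Phi>" for v n
  proof -
    have "G \<star> v n = G \<star> e (v, n) \<star> v n" using pi[OF that, of n] by (simp add: e_def comp_assoc)
    also have "\<dots> = v n" using Ge[of "(v, n)"] pi[OF that, of n] that by (simp add: e_def comp_assoc)
    finally show ?thesis .
  qed
  have adjG: "adj G = G" "G \<star> G = G" using Gp by (auto simp: projection_def)
  have vG: "adj (v n) \<star> G = adj (v n)" if "v \<in> \<Phi>" for v n
  proof -
    have "adj (G \<star> v n) = adj (v n)" using Gv[OF that] by simp
    then show ?thesis using GM vM[OF that] adjG by simp
  qed
  \<comment> \<open>Copies orthogonal to G would be orthogonal to the family, hence belong to it by
    maximality, and so lie under G.\<close>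
  have notG: False if v: "orthogonal_copies v" and 0: "\<And>n. G \<star> v n = 0" for v
  proof -
    have "adj (w m) \<star> v n = 0" if "w \<in> \<Phi>" for w m n
      using comp_reassoc[OF vG[OF that], of m "v n"] 0[of n] by simp
    then have "v \<in> \<Phi>" using max'[OF v] by blast
    then have "v 0 = 0" using Gv[of v 0] 0[of 0] by simp
    then show False using v unfolding orthogonal_copies_def by (metis comp_simps(2))
  qed
  define R where "R = id_blinfun - G"
  have R: "R \<in> M" "projection R" using GM Gp by (simp_all add: R_def projection_id_minus)
  have adjR: "adj R = R" using R by (simp add: projection_def)
  have GR: "G \<star> R = 0" by (simp add: R_def comp_distribs adjG)
  obtain U where U: "U \<in> M" "U \<star> R = U" "G \<star> U = U" "U \<star> (adj U \<star> U) = U"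
    and U0: "\<And>X. X \<in> M \<Longrightarrow> (R - adj U \<star> U) \<star> X \<star> (G - U \<star> adj U) = 0"
    using maximal_partial_isometry[OF R GM Gp] by blast
  have RU: "R \<star> adj U = adj U"
  proof -
    have "adj (U \<star> R) = adj U" using U by simp
    then show ?thesis using R(1) U(1) adjR by simp
  qed
  have GU: "G \<star> adj U = 0" using comp_reassoc[OF GR, of "adj U"] RU by simp
  define Y D where "Y = R - adj U \<star> U" and "D = G - U \<star> adj U"
  obtain q where q: "q \<in> M" "q \<in> commutant M" "projection q" "Y \<star> q = 0" and qT: "\<forall>T::'a op. (\<forall>X\<in>M. Y \<star> X \<star> T = 0) \<longrightarrow> q \<star> T = T"
    by (rule central_annihilator[of Y]) (use R U in \<open>auto simp: Y_def\<close>)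
  define c where "c = id_blinfun - q"
  have c: "c \<in> M" "projection c" using q by (simp_all add: c_def projection_id_minus)
  have cc: "c \<star> T = T \<star> c" if "T \<in> M" for T using commutant_commute[OF q(2) that] by (simp add: c_def comp_distribs)
  have adjc: "adj c = c" "c \<star> c = c" using c by (auto simp: projection_def)
  have "q \<star> D = D" using qT U0 unfolding Y_def D_def by blast
  then have cD: "c \<star> D = 0" by (simp add: c_def comp_distribs)
  have vc: "v n \<star> c = 0" if v: "v \<in> \<Phi>" for v n
  proof -
    obtain F where F: "projection F" and vv: "\<And>m n. adj (v m) \<star> v n = (if m = n then F else 0)"
      using cop[OF v] by (auto simp: orthogonal_copies_def)
    have FM: "F \<in> M" using vv[of 0 0] vM[OF v, of 0] by (metis M_closed(5) adj_in_M)
    \<comment> \<open>Under c the copies v_n lie in the range of U, so U^* carries them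
      isometrically into R. Were F c nonzero, these would be copies orthogonal to G, contrary to
      \<open>notG\<close>.\<close>
    define w where "w n = adj U \<star> v n \<star> c" for n
    have ww: "adj (w m) \<star> w n = (if m = n then F \<star> c else 0)" for m n
    proof -
      have Dv: "D \<star> (v n \<star> c) = 0"
      proof -
        have "D \<in> M" using GM U by (simp add: D_def)
        then have "D \<star> c = 0" using cc[of D] cD by simp
        moreover have "v n \<star> c = c \<star> v n" using cc[OF vM[OF v]] by simp
        ultimately show ?thesis using comp_reassoc[of D c 0 "v n"] by simp
      qed
      have "adj (w m) \<star> w n = c \<star> adj (v m) \<star> ((U \<star> adj U) \<star> (v n \<star> c))"
        unfolding w_def using U(1) vM[OF v] c(1) by (simp add: adjc comp_assoc)
      also have "(U \<star> adj U) \<star> (v n \<star> c) = v n \<star> c"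
      proof -
        have "U \<star> adj U = G - D" by (simp add: D_def)
        then show ?thesis using Dv Gv[OF v, of n] comp_reassoc[OF Gv[OF v, of n], of c] by (simp add: comp_distribs)
      qed
      also have "c \<star> adj (v m) \<star> (v n \<star> c) = c \<star> (adj (v m) \<star> v n) \<star> c" by (simp add: comp_assoc)
      also have "\<dots> = (if m = n then F \<star> c else 0)"
        by (simp add: vv comp_assoc comp_reassoc[OF cc[OF FM]] adjc)
      finally show ?thesis .
    qed
    have "F \<star> c = 0"
    proof (rule ccontr)
      assume nz: "F \<star> c \<noteq> 0"
      have "projection (F \<star> c)"
      proof -
        have FF: "adj F = F" "F \<star> F = F" using F by (auto simp: projection_def)
        have "F \<star> c \<star> (F \<star> c) = F \<star> (c \<star> F) \<star> c" by (simp add: comp_assoc)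
        also have "\<dots> = F \<star> c" using comp_reassoc[OF FF(2), of c] by (simp add: comp_reassoc[OF cc[OF FM]] comp_assoc adjc)
        finally show ?thesis using FM c(1) by (simp add: projection_def FF adjc cc[OF FM])
      qed
      then have "orthogonal_copies w"
        unfolding orthogonal_copies_def using nz ww U(1) vM[OF v] c(1)
        by (intro conjI exI[of _ "F \<star> c"]) (auto simp: w_def)
      moreover have "G \<star> w n = 0" for n
        using comp_reassoc[OF GU, of "v n \<star> c"] by (simp add: w_def comp_assoc)
      ultimately show False by (rule notG)
    qed
    moreover have "adj (v n \<star> c) \<star> (v n \<star> c) = c \<star> (adj (v n) \<star> v n) \<star> c"
      using vM[OF v] c by (simp add: adjc comp_assoc)
    ultimately have "adj (v n \<star> c) \<star> (v n \<star> c) = 0" by (simp add: vv comp_assoc)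
    then show ?thesis by (rule adj_comp_self_eq_0[rotated]) (use vM[OF v] c in simp)
  qed
  have "c = 0"
  proof (rule ccontr)
    assume "c \<noteq> 0"
    moreover have "c \<in> commutant M" using cc c by (simp add: commutant_def)
    ultimately have "\<not> finite_projection M c" using inf c unfolding properly_infinite_def by blast
    then obtain v where v: "orthogonal_copies v" "\<And>n. c \<star> v n = v n"
      using orthogonal_copies_of_infinite_projection[OF c] by blast
    have "e i \<star> c = 0" if "i \<in> \<Phi> \<times> UNIV" for i
    proof -
      obtain u n where i: "i = (u, n)" "u \<in> \<Phi>" using \<open>i \<in> \<Phi> \<times> UNIV\<close> by auto
      have "e i \<star> c = u n \<star> (adj (u n) \<star> c)" by (simp add: i e_def comp_assoc)
      also have "adj (u n) \<star> c = c \<star> adj (u n)" using cc[of "adj (u n)"] vM[OF i(2)] by simp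
      also have "u n \<star> (c \<star> adj (u n)) = 0" using comp_reassoc[OF vc[OF i(2), of n], of "adj (u n)"] by simp
      finally show ?thesis .
    qed
    then have "G \<star> c = 0" by (rule strong_sum_zero[OF strong_sum_comp_right[OF Gsum]])
    then have "G \<star> v n = 0" for n using v(2)[of n] comp_reassoc[of G c 0 "v n"] by simp
    then show False by (rule notG[OF v(1)])
  qed
  \<comment> \<open>Now Y = Y q = 0, so the initial space of U is all of R.\<close>
  then have "q = id_blinfun" by (simp add: c_def)
  then have "adj U \<star> U = R" using q(4) by (simp add: Y_def)
  then have UU: "adj U \<star> U + G = id_blinfun" by (simp add: R_def)
  \<comment> \<open>Even indices for S and odd indices for T: both have initial projection G, with
    orthogonal ranges under G.\<close>
  obtain S where S: "S \<in> M" "adj S \<star> S = G" "G \<star> S = S" "strong_sum (\<lambda>(v, n). v (2 * n) \<star> adj (v n)) (\<Phi> \<times> UNIV) S"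
  proof (rule copies_shift[of \<Phi> G "\<lambda>n. 2 * n"])
    show "strong_sum (\<lambda>(v, n). v n \<star> adj (v n)) (\<Phi> \<times> UNIV) G" using Gsum by (simp add: e_def)
  qed (use cop orth Gv that in \<open>auto simp: inj_def\<close>)
  obtain T where T: "T \<in> M" "adj T \<star> T = G" "G \<star> T = T" "strong_sum (\<lambda>(v, n). v (2 * n + 1) \<star> adj (v n)) (\<Phi> \<times> UNIV) T"
  proof (rule copies_shift[of \<Phi> G "\<lambda>n. 2 * n + 1"])
    show "strong_sum (\<lambda>(v, n). v n \<star> adj (v n)) (\<Phi> \<times> UNIV) G" using Gsum by (simp add: e_def)
  qed (use cop orth Gv that in \<open>auto simp: inj_def\<close>)
  have "adj S \<star> T = 0"
  proof (rule strong_sum_zero[OF strong_sum_comp_left[OF T(4)]])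
    fix i assume "i \<in> \<Phi> \<times> (UNIV::nat set)"
    then obtain v n where i: "i = (v, n)" "v \<in> \<Phi>" by auto
    have "adj (v (2 * n + 1)) \<star> S = 0"
    proof (rule strong_sum_zero[OF strong_sum_comp_left[OF S(4)]])
      fix j assume "j \<in> \<Phi> \<times> (UNIV::nat set)"
      then obtain w m where j: "j = (w, m)" "w \<in> \<Phi>" by auto
      have "adj (v (2 * n + 1)) \<star> w (2 * m) = 0" using i j by (intro ne) (auto, presburger)
      from comp_reassoc[OF this, of "adj (w m)"]
      show "adj (v (2 * n + 1)) \<star> (case j of (v, n) \<Rightarrow> v (2 * n) \<star> adj (v n)) = 0" by (simp add: j)
    qed
    then have "adj (adj (v (2 * n + 1)) \<star> S) = 0" by simp
    then have "adj S \<star> v (2 * n + 1) = 0" using vM[OF i(2)] S(1) by simp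
    from comp_reassoc[OF this, of "adj (v n)"]
    show "adj S \<star> (case i of (v, n) \<Rightarrow> v (2 * n + 1) \<star> adj (v n)) = 0" by (simp add: i)
  qed
  note ST = this
  have TS: "adj T \<star> S = 0"
  proof -
    have "adj (adj S \<star> T) = 0" using ST by simp
    then show ?thesis using S T by simp
  qed
  \<comment> \<open>W carries I = R + G isometrically into G: R goes through U and then S, and G
    through T. On the range of W both S and T are isometric, so S W and T W are the required
    pair.\<close>
  define W where "W = S \<star> U + T \<star> G"
  have WM: "W \<in> M" using S T U GM by (simp add: W_def)
  have WW: "adj W \<star> W = id_blinfun"
  proof -
    have "adj W \<star> W = adj U \<star> U + G"
      unfolding W_def using S(1) T(1) U(1) GM
      by (simp add: comp_distribs comp_assoc adjG comp_reassoc[OF ST] comp_reassoc[OF TS]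
          comp_reassoc[OF S(2)] comp_reassoc[OF T(2)] U(3))
    then show ?thesis by (simp add: UU)
  qed
  have GW: "G \<star> W = W" by (simp add: W_def comp_distribs comp_reassoc[OF S(3)] comp_reassoc[OF T(3)])
  show thesis
  proof (rule that[of "S \<star> W" "T \<star> W"])
    show "adj (S \<star> W) \<star> (S \<star> W) = id_blinfun" "adj (T \<star> W) \<star> (T \<star> W) = id_blinfun" "adj (S \<star> W) \<star> (T \<star> W) = 0"
      using S(1) T(1) WM
      by (simp_all add: comp_assoc comp_reassoc[OF S(2)] comp_reassoc[OF T(2)] comp_reassoc[OF ST] GW WW)
  qed (use S T WM in simp_all)
qed

end

subsection \<open>Indexed sums\<close>

text \<open>One limit for both cases: for finite N the truncated sums are eventually
  constant.\<close>

lemma op_sums_iff: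
  "op_sums N T S \<longleftrightarrow> (\<forall>x. (\<lambda>n. \<Sum>j\<in>{1..n} \<inter> index_set N. blinfun_apply (T j) x) \<longlonglongrightarrow> blinfun_apply S x)"
proof (cases N)
  case (enat m)
  have lim: "(\<lambda>n. \<Sum>j\<in>{1..n} \<inter> index_set N. blinfun_apply (T j) x) \<longlonglongrightarrow> (\<Sum>j=1..m. blinfun_apply (T j) x)" for x
  proof (rule tendsto_eventually)
    have "{1..n} \<inter> index_set N = {1..m}" if "n \<ge> m" for n using that enat by (auto simp: index_set_def)
    then show "\<forall>\<^sub>F n in sequentially. (\<Sum>j\<in>{1..n} \<inter> index_set N. blinfun_apply (T j) x) = (\<Sum>j=1..m. blinfun_apply (T j) x)"
      unfolding eventually_sequentially by metis
  qed
  show ?thesis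
  proof
    assume "op_sums N T S"
    then have "S = (\<Sum>j=1..m. T j)" using enat by (simp add: op_sums_def)
    then show "\<forall>x. (\<lambda>n. \<Sum>j\<in>{1..n} \<inter> index_set N. blinfun_apply (T j) x) \<longlonglongrightarrow> blinfun_apply S x"
      using lim by (simp add: blinfun.sum_left)
  next
    assume "\<forall>x. (\<lambda>n. \<Sum>j\<in>{1..n} \<inter> index_set N. blinfun_apply (T j) x) \<longlonglongrightarrow> blinfun_apply S x"
    then have "S x = (\<Sum>j=1..m. blinfun_apply (T j) x)" for x using lim LIMSEQ_unique by blast
    then have "S = (\<Sum>j=1..m. T j)" by (intro blinfun_eqI) (simp add: blinfun.sum_left)
    then show "op_sums N T S" using enat by (simp add: op_sums_def)
  qed
next
  case infinity
  then have "{1..n} \<inter> index_set N = {1..n}" for n by (auto simp: index_set_def)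
  then show ?thesis using infinity by (simp add: op_sums_def)
qed

lemma op_sums_unique: "op_sums N T S \<Longrightarrow> op_sums N T S' \<Longrightarrow> S = S'"
  unfolding op_sums_iff by (intro blinfun_eqI) (metis LIMSEQ_unique)

lemma op_sums_cong: "(\<And>j. j \<in> index_set N \<Longrightarrow> T j = T' j) \<Longrightarrow> op_sums N T S \<longleftrightarrow> op_sums N T' S"
  unfolding op_sums_iff by simp

lemma op_sums_comp_left: "op_sums N T S \<Longrightarrow> op_sums N (\<lambda>j. X \<star> T j) (X \<star> S)"
  unfolding op_sums_iff
proof
  fix x assume "\<forall>x. (\<lambda>n. \<Sum>j\<in>{1..n} \<inter> index_set N. blinfun_apply (T j) x) \<longlonglongrightarrow> blinfun_apply S x"
  then have "(\<lambda>n. X (\<Sum>j\<in>{1..n} \<inter> index_set N. blinfun_apply (T j) x)) \<longlonglongrightarrow> X (S x)"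
    by (intro blinfun.tendsto tendsto_const) blast
  then show "(\<lambda>n. \<Sum>j\<in>{1..n} \<inter> index_set N. (X \<star> T j) x) \<longlonglongrightarrow> (X \<star> S) x"
    by (simp add: blinfun.sum_right)
qed

lemma op_sums_comp_right: "op_sums N T S \<Longrightarrow> op_sums N (\<lambda>j. T j \<star> X) (S \<star> X)"
  unfolding op_sums_iff by simp

lemma finite_subset_index_set:
  assumes "finite X" "X \<subseteq> index_set N" "Max X \<le> n"
  shows "X \<subseteq> {1..n} \<inter> index_set N"
proof
  fix x assume "x \<in> X"
  then have "x \<le> Max X" "x \<in> index_set N" using assms by auto
  then show "x \<in> {1..n} \<inter> index_set N" using assms(3) by (simp add: index_set_def)
qed

text \<open>Every finite subset of the index set is contained in an initial segment, so the ordered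
  partial sums follow the net of finite sums.\<close>

lemma strong_sum_imp_op_sums:
  assumes "strong_sum T (index_set N) S" shows "op_sums N T S"
proof -
  have "filterlim (\<lambda>n. {1..n} \<inter> index_set N) (finite_subsets_at_top (index_set N)) sequentially"
    unfolding filterlim_finite_subsets_at_top
  proof (intro allI impI)
    fix X assume X: "finite X \<and> X \<subseteq> index_set N"
    have "X \<subseteq> {1..n} \<inter> index_set N" if "n \<ge> Max X" for n
      using X that by (intro finite_subset_index_set) auto
    then show "\<forall>\<^sub>F n in sequentially. finite ({1..n} \<inter> index_set N) \<and> X \<subseteq> {1..n} \<inter> index_set N \<and> {1..n} \<inter> index_set N \<subseteq> index_set N"
      unfolding eventually_sequentially by auto
  qed
  then show ?thesis
    using assms unfolding op_sums_iff strong_sum_def has_sum_def by (auto intro: filterlim_compose)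
qed

lemma op_sums_single:
  assumes S: "op_sums N T S" and k: "k \<in> index_set N" and 0: "\<And>j. j \<in> index_set N \<Longrightarrow> j \<noteq> k \<Longrightarrow> T j = 0"
  shows "S = T k"
proof -
  have "op_sums N T (T k)"
  proof (rule strong_sum_imp_op_sums, unfold strong_sum_def, rule)
    fix x
    have "((\<lambda>i. T i x) has_sum T k x) {k}" by (simp add: has_sum_finite_iff)
    then show "((\<lambda>i. T i x) has_sum T k x) (index_set N)"
      by (rule has_sum_cong_neutral[THEN iffD1, rotated -1]) (use k 0 in auto)
  qed
  then show ?thesis using S op_sums_unique by blast
qed

lemma op_sums_add_at:
  assumes S: "op_sums N T S" and k: "k \<in> index_set N"
  shows "op_sums N (\<lambda>j. if j = k then T j + Q else T j) (S + Q)"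
  unfolding op_sums_iff
proof
  fix x
  have lim: "(\<lambda>n. (\<Sum>j\<in>{1..n} \<inter> index_set N. T j x) + Q x) \<longlonglongrightarrow> S x + Q x"
    using S unfolding op_sums_iff by (intro tendsto_add tendsto_const) blast
  have "(\<Sum>j\<in>{1..n} \<inter> index_set N. (if j = k then T j + Q else T j) x) = (\<Sum>j\<in>{1..n} \<inter> index_set N. T j x) + Q x"
    if "n \<ge> k" for n
  proof -
    have k': "k \<in> {1..n} \<inter> index_set N" using that k by (auto simp: index_set_def)
    have "(\<Sum>j\<in>{1..n} \<inter> index_set N. (if j = k then T j + Q else T j) x)
        = (\<Sum>j\<in>{1..n} \<inter> index_set N. T j x + (if j = k then Q x else 0))"
      by (intro sum.cong) (auto simp: blinfun.bilinear_simps)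
    also have "\<dots> = (\<Sum>j\<in>{1..n} \<inter> index_set N. T j x) + Q x"
      using k' by (simp add: sum.distrib)
    finally show ?thesis .
  qed
  then have "\<forall>\<^sub>F n in sequentially. (\<Sum>j\<in>{1..n} \<inter> index_set N. T j x) + Q x
      = (\<Sum>j\<in>{1..n} \<inter> index_set N. (if j = k then T j + Q else T j) x)"
    by (intro eventually_sequentiallyI[of k]) (rule sym)
  from Lim_transform_eventually[OF lim this]
  show "(\<lambda>n. \<Sum>j\<in>{1..n} \<inter> index_set N. (if j = k then T j + Q else T j) x) \<longlonglongrightarrow> (S + Q) x"
    by (simp add: blinfun.bilinear_simps)
qed

text \<open>Positive terms make the sums increase with the index set, and every finite set lies in
  an initial segment. This dominates arbitrary finite partial sums by A.\<close>

lemma op_sums_partial_le: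
  assumes A: "op_sums N C A" and pos: "\<And>j x. j \<in> index_set N \<Longrightarrow> 0 \<le> inner (C j x) x"
    and F: "finite F" "F \<subseteq> index_set N"
  shows "(\<Sum>j\<in>F. inner (C j x) x) \<le> inner (A x) x"
proof (rule tendsto_lowerbound)
  have "(\<lambda>n. inner (\<Sum>j\<in>{1..n} \<inter> index_set N. C j x) x) \<longlonglongrightarrow> inner (A x) x"
    using A unfolding op_sums_iff by (intro tendsto_inner tendsto_const) blast
  then show "(\<lambda>n. \<Sum>j\<in>{1..n} \<inter> index_set N. inner (C j x) x) \<longlonglongrightarrow> inner (A x) x"
    by (simp add: inner_sum_left)
  have "(\<Sum>j\<in>F. inner (C j x) x) \<le> (\<Sum>j\<in>{1..n} \<inter> index_set N. inner (C j x) x)" if "n \<ge> Max F" for n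
  proof (rule sum_mono2)
    show "F \<subseteq> {1..n} \<inter> index_set N" using F that by (rule finite_subset_index_set)
  qed (use pos in auto)
  then show "\<forall>\<^sub>F n in sequentially. (\<Sum>j\<in>F. inner (C j x) x) \<le> (\<Sum>j\<in>{1..n} \<inter> index_set N. inner (C j x) x)"
    unfolding eventually_sequentially by blast
qed simp

text \<open>The square of b (I - P), read as (b - b P)^* (b - b P), involves only b b, which P
  fixes, and so vanishes. Properties of A pass in this way to its square root.\<close>

lemma comp_eq_of_comp_square:
  assumes b: "b \<in> bounded_ops" "adj b = b" and P: "P \<in> bounded_ops" "adj P = P" "P \<star> (b \<star> b) = b \<star> b"
  shows "P \<star> b = b"
proof -
  have "adj (b - b \<star> P) \<star> (b - b \<star> P) = b \<star> b - b \<star> b \<star> P - (P \<star> (b \<star> b) - P \<star> (b \<star> b) \<star> P)"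
    using b P(1,2) by (simp add: comp_distribs comp_assoc)
  also have "\<dots> = 0" by (simp add: P(3))
  finally have "b - b \<star> P = 0" by (rule adj_comp_self_eq_0[rotated]) (use b P in simp)
  then have "b \<star> P = b" unfolding right_minus_eq by (rule sym)
  then have "adj (b \<star> P) = b" using b by simp
  then show ?thesis using b P(1,2) by simp
qed

section \<open>Passing between sum decompositions and diagonal compressions\<close>

context von_neumann
begin

text \<open>The projections W^n R W^{*n} are mutually orthogonal since R is orthogonal to the range
  of W. On their sum K the operator T acts as W, which frees R, and off K it is the
  identity.\<close>

lemma isometry_onto_complement:
  assumes W: "W \<in> M" "adj W \<star> W = id_blinfun" and R: "R \<in> M" "projection R" and WR: "adj W \<star> R = 0"
  obtains T where "T \<in> M" "adj T \<star> T = id_blinfun" "T \<star> adj T = id_blinfun - R"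
proof -
  have adjR: "adj R = R" "R \<star> R = R" using R by (auto simp: projection_def)
  have RW: "R \<star> W = 0"
  proof -
    have "adj (adj W \<star> R) = 0" using WR by simp
    then show ?thesis using W(1) R(1) adjR by simp
  qed
  define p where "p = rec_nat R (\<lambda>_ Y. W \<star> Y \<star> adj W)"
  have p0: "p 0 = R" and pS: "p (Suc n) = W \<star> p n \<star> adj W" for n by (simp_all add: p_def)
  have pM: "p n \<in> M \<and> adj (p n) = p n" for n
    by (induction n) (use R W adjR in \<open>auto simp: p0 pS comp_assoc\<close>)
  have pp: "p m \<star> p n = (if m = n then p m else 0)" for m n
  proof (induction m arbitrary: n)
    case 0
    show ?case by (cases n) (simp_all add: p0 pS adjR comp_assoc comp_reassoc[OF RW])
  next
    case (Suc m)
    show ?case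
    proof (cases n)
      case 0
      then show ?thesis by (simp add: p0 pS comp_assoc WR)
    next
      case (Suc k)
      have "p (Suc m) \<star> p (Suc k) = W \<star> (p m \<star> p k) \<star> adj W" by (simp add: pS comp_assoc comp_reassoc[OF W(2)])
      then show ?thesis using Suc.IH[of k] Suc by (simp add: pS)
    qed
  qed
  obtain K where K: "K \<in> M" "strong_sum p UNIV K" "projection K"
    by (rule projection_strong_sum[of UNIV p]) (use pM pp in \<open>auto simp: projection_def\<close>)
  have adjK: "adj K = K" "K \<star> K = K" using K by (auto simp: projection_def)
  \<comment> \<open>Conjugation by W moves each summand of K to the next and so removes exactly the
    first one, R.\<close>
  have WKW: "W \<star> K \<star> adj W = K - R"
  proof (rule blinfun_eqI)
    fix x
    have "(\<lambda>n. p n x) sums K x" using K(2) by (simp add: strong_sum_def has_sum_imp_sums)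
    then have "(\<lambda>n. p (Suc n) x) sums (K x - R x)" by (simp add: sums_Suc_iff[of "\<lambda>n. p n x"] p0)
    moreover have "(\<lambda>n. p (Suc n) x) sums (W \<star> K \<star> adj W) x"
      using strong_sum_comp_right[OF strong_sum_comp_left[OF K(2), of W], of "adj W"]
      unfolding pS strong_sum_def by (blast intro: has_sum_imp_sums)
    ultimately show "(W \<star> K \<star> adj W) x = (K - R) x" by (simp add: sums_unique2 blinfun.bilinear_simps)
  qed
  have WK: "W \<star> K = K \<star> W"
  proof -
    have "W \<star> K = W \<star> K \<star> adj W \<star> W" by (simp add: comp_assoc W)
    also have "\<dots> = K \<star> W" by (simp add: WKW comp_distribs RW)
    finally show ?thesis .
  qed
  have KW: "K \<star> adj W = adj W \<star> K"
  proof -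
    have "adj (W \<star> K) = adj (K \<star> W)" using WK by simp
    then show ?thesis using W K(1) by (simp add: adjK)
  qed
  define T where "T = W \<star> K + (id_blinfun - K)"
  have adjT: "adj T = K \<star> adj W + (id_blinfun - K)" using W(1) K(1) by (simp add: T_def adjK)
  show thesis
  proof
    show "T \<in> M" using W K by (simp add: T_def)
    show "adj T \<star> T = id_blinfun"
      unfolding adjT unfolding T_def
      by (simp add: comp_distribs comp_assoc W(2) comp_reassoc[OF W(2)] adjK KW comp_reassoc[OF KW]
          WK[symmetric] comp_reassoc[OF WK[symmetric]])
    show "T \<star> adj T = id_blinfun - R"
      unfolding adjT unfolding T_def using WKW
      by (simp add: comp_distribs comp_assoc adjK comp_reassoc[OF adjK(2)])
  qed
qed

text \<open>With b a self-adjoint root of B, the operator Y b is the witness, as Y^* Y cancels on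
  one side.\<close>

lemma op_equiv_conjugate:
  assumes B: "B \<in> pos_part M" and Y: "Y \<in> M" "adj Y \<star> Y = id_blinfun"
  shows "op_equiv M (Y \<star> B \<star> adj Y) B"
proof -
  obtain b where b: "b \<in> M" "adj b = b" "b \<star> b = B" using sqrt_exists[OF B] .
  show ?thesis unfolding op_equiv_def
  proof (rule bexI[of _ "Y \<star> b"], intro conjI)
    show "Y \<star> B \<star> adj Y = Y \<star> b \<star> adj (Y \<star> b)" using Y b(1,2) by (simp add: comp_assoc comp_reassoc[OF b(3)])
    show "B = adj (Y \<star> b) \<star> (Y \<star> b)" using Y(1) b(1,2) by (simp add: comp_assoc comp_reassoc[OF Y(2)] b(3))
  qed (use Y b in simp)
qed

text \<open>The isometries are a parameter, and only those indexed by \<open>index_set N\<close> are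
  used. The others, W 0 in particular, stay orthogonal to P and remain available for extending
  V.\<close>

lemma compression_of_sum:
  assumes A: "A \<in> pos_part M" and sd: "sum_decomposition M N A B C"
    and W: "\<And>j. W j \<in> M" "\<And>i j. adj (W i) \<star> W j = (if i = j then id_blinfun else 0)"
  obtains V P where "V \<in> M" "adj V \<star> V = range_proj A" "P \<in> M" "projection P"
    "op_sums N (\<lambda>j. W j \<star> adj (W j)) P" "P \<star> V = V"
    "\<forall>j\<in>index_set N. P \<star> W j = W j" "\<forall>k. k \<notin> index_set N \<longrightarrow> adj (W k) \<star> P = 0"
    "\<forall>j\<in>index_set N. W j \<star> adj (W j) \<star> V \<star> A \<star> adj V \<star> W j \<star> adj (W j) = W j \<star> B j \<star> adj (W j)"
proof -
  let ?J = "index_set N"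
  have AM: "A \<in> M" and Apos: "positive_op A" using A by (auto simp: pos_part_def)
  have C: "\<forall>j\<in>?J. \<exists>X\<in>M. C j = X \<star> adj X \<and> B j = adj X \<star> X" and CA: "op_sums N C A"
    using sd by (auto simp: sum_decomposition_def op_equiv_def)
  obtain X where X: "\<And>j. j \<in> ?J \<Longrightarrow> X j \<in> M" "\<And>j. j \<in> ?J \<Longrightarrow> C j = X j \<star> adj (X j)"
    "\<And>j. j \<in> ?J \<Longrightarrow> B j = adj (X j) \<star> X j" using C by metis
  define Z where "Z j = W j \<star> adj (X j)" for j
  have adjZ: "adj (Z j) = X j \<star> adj (W j)" if "j \<in> ?J" for j using X(1)[OF that] W(1)[of j] by (simp add: Z_def)
  have ZZ: "adj (Z i) \<star> Z j = (if i = j then C j else 0)" if "i \<in> ?J" "j \<in> ?J" for i j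
    unfolding adjZ[OF that(1)] using X(2)[OF that(2)]
    by (simp add: Z_def comp_assoc comp_reassoc[OF W(2)])
  have ZM: "Z j \<in> M" if "j \<in> ?J" for j using X(1)[OF that] W(1)[of j] by (simp add: Z_def)
  have CZ: "inner (C j x) x = (norm (Z j x))\<^sup>2" if "j \<in> ?J" for j x
  proof -
    have "inner (Z j x) (Z j x) = inner x ((adj (Z j) \<star> Z j) x)" using ZM[OF that] by (simp add: inner_adj)
    then show ?thesis using ZZ[OF that that] by (simp add: power2_norm_eq_inner inner_commute)
  qed
  have bnd: "(\<Sum>j\<in>F. (norm (Z j x))\<^sup>2) \<le> norm A * (norm x)\<^sup>2" if F: "finite F" "F \<subseteq> ?J" for F x
  proof -
    have "(\<Sum>j\<in>F. (norm (Z j x))\<^sup>2) = (\<Sum>j\<in>F. inner (C j x) x)"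
      using F CZ by (intro sum.cong) auto
    also have "\<dots> \<le> inner (A x) x" by (rule op_sums_partial_le[OF CA _ F]) (simp add: CZ)
    also have "\<dots> \<le> norm (A x) * norm x" by (rule norm_cauchy_schwarz)
    also have "\<dots> \<le> norm A * norm x * norm x" by (intro mult_right_mono norm_blinfun) auto
    finally show ?thesis by (simp add: power2_eq_square mult.assoc)
  qed
  obtain S where S: "S \<in> M" "strong_sum Z ?J S" "strong_sum (\<lambda>j. adj (Z j) \<star> Z j) ?J (adj S \<star> S)"
    by (rule orthogonal_strong_sum[of ?J Z "norm A"]) (use ZM ZZ bnd in auto)
  have SS: "adj S \<star> S = A"
  proof (rule op_sums_unique[OF _ CA])
    have "strong_sum C ?J (adj S \<star> S)" using S(3) strong_sum_cong[of ?J "\<lambda>j. adj (Z j) \<star> Z j" C] ZZ by simp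
    then show "op_sums N C (adj S \<star> S)" by (rule strong_sum_imp_op_sums)
  qed
  obtain D where D: "D \<in> M" "adj D = D" "D \<star> D = A" using sqrt_exists[OF A] .
  obtain V where V: "V \<in> M" "V \<star> D = S" "adj V \<star> V = range_proj D"
    by (rule partial_isometry_exists[of S D]) (use S D SS in auto)
  \<comment> \<open>V is built from the root D, so its initial projection is that of D; D and D D =
    A have the same closed range because D is self-adjoint.\<close>
  have rD: "range_proj D = range_proj A"
  proof -
    have p: "projection (range_proj D)" "projection (range_proj A)" "range_proj D \<star> D = D" "range_proj A \<star> A = A"
      using D AM by (simp_all add: range_proj)
    have "range_proj A \<star> D = D"
      by (rule comp_eq_of_comp_square) (use p D AM in \<open>auto simp: projection_def\<close>)
    then have 1: "range_proj A \<star> range_proj D = range_proj D"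
      using comp_range_proj_eq[of D "range_proj A" id_blinfun] D by simp
    have "range_proj D \<star> A = A" using comp_reassoc[OF p(3), of D] D by simp
    then have "range_proj D \<star> range_proj A = range_proj A"
      using comp_range_proj_eq[of A "range_proj D" id_blinfun] AM by simp
    then have "adj (range_proj D \<star> range_proj A) = range_proj A" using p by (simp add: projection_def)
    then show ?thesis using 1 p by (simp add: projection_def)
  qed
  have Vpi: "V \<star> range_proj D = V"
    using V D partial_isometry_comp[of V] by (simp add: projection_range_proj)
  obtain P where P: "P \<in> M" "strong_sum (\<lambda>j. W j \<star> adj (W j)) ?J P" "projection P"
    and PE: "\<And>k. k \<in> ?J \<Longrightarrow> P \<star> (W k \<star> adj (W k)) = W k \<star> adj (W k)"
  proof (rule projection_strong_sum[of ?J "\<lambda>j. W j \<star> adj (W j)"])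
    fix i j
    show "W i \<star> adj (W i) \<in> M" "projection (W i \<star> adj (W i))"
      using W by (auto intro!: projection_comp_adj)
    show "i \<noteq> j \<Longrightarrow> W i \<star> adj (W i) \<star> (W j \<star> adj (W j)) = 0"
      by (simp add: comp_assoc comp_reassoc[OF W(2)])
  qed (rule that)
  have PW: "P \<star> W j = W j" if "j \<in> ?J" for j
  proof -
    have "P \<star> W j = P \<star> (W j \<star> adj (W j)) \<star> W j" by (simp add: comp_assoc W)
    also have "\<dots> = W j" unfolding PE[OF that] by (simp add: comp_assoc W)
    finally show ?thesis .
  qed
  have "P \<star> S = S" by (rule strong_sum_comp_eq[OF S(2)]) (simp add: Z_def comp_reassoc[OF PW])
  then have "(P \<star> V) \<star> D = V \<star> D" using V by (simp add: comp_assoc)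
  then have "(P \<star> V) \<star> range_proj D = V \<star> range_proj D" using D by (intro comp_range_proj_eq) auto
  then have PV: "P \<star> V = V" by (simp add: comp_assoc Vpi)
  have WP: "adj (W k) \<star> P = 0" if "k \<notin> ?J" for k
    by (rule strong_sum_zero[OF strong_sum_comp_left[OF P(2)]])
      (use that in \<open>auto simp: comp_reassoc[OF W(2)]\<close>)
  \<comment> \<open>The projection W_j W_j^* selects the j-th term of S, since the other terms have
    orthogonal ranges.\<close>
  have WS: "W j \<star> (adj (W j) \<star> S) = Z j" if "j \<in> ?J" for j
  proof -
    have "adj (W j) \<star> S = adj (W j) \<star> Z j"
      by (rule strong_sum_single[OF strong_sum_comp_left[OF S(2)] that])
        (auto simp: Z_def comp_reassoc[OF W(2)])
    then show ?thesis by (simp add: Z_def comp_reassoc[OF W(2)])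
  qed
  have "W j \<star> adj (W j) \<star> V \<star> A \<star> adj V \<star> W j \<star> adj (W j) = W j \<star> B j \<star> adj (W j)" if j: "j \<in> ?J" for j
  proof -
    have "V \<star> A \<star> adj V = S \<star> adj S"
      unfolding D(3)[symmetric] V(2)[symmetric] using V(1) D(1,2) by (simp add: comp_assoc)
    moreover have "W j \<star> adj (W j) \<star> V \<star> A \<star> adj V \<star> W j \<star> adj (W j)
        = W j \<star> adj (W j) \<star> (V \<star> A \<star> adj V) \<star> (W j \<star> adj (W j))"
      by (simp only: comp_assoc)
    ultimately have "W j \<star> adj (W j) \<star> V \<star> A \<star> adj V \<star> W j \<star> adj (W j)
        = (W j \<star> (adj (W j) \<star> S)) \<star> (adj S \<star> (W j \<star> adj (W j)))"
      by (simp only: comp_assoc)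
    also have "adj S \<star> (W j \<star> adj (W j)) = adj (W j \<star> (adj (W j) \<star> S))"
      using S(1) W(1)[of j] by (simp add: comp_assoc)
    also have "(W j \<star> (adj (W j) \<star> S)) \<star> \<dots> = Z j \<star> adj (Z j)" by (simp add: WS[OF j])
    also have "\<dots> = W j \<star> B j \<star> adj (W j)" unfolding adjZ[OF j] X(3)[OF j] by (simp add: Z_def comp_assoc)
    finally show ?thesis .
  qed
  then show thesis
    using that[of V P] V rD P PV PW WP strong_sum_imp_op_sums[OF P(2)] by auto
qed

text \<open>For X_j = D V^* E_j with D a root of A, one product X_j^* X_j is the given compression
  and the other is C_j. The C_j add up to D V^* P V D, which is D D = A because P fixes the range of
  V and V^* V fixes that of D.\<close>

lemma diagonal_compression_imp_sum:
  assumes A: "A \<in> pos_part M" and B: "\<And>j. j \<in> index_set N \<Longrightarrow> B j \<in> pos_part M"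
    and dc: "diagonal_compression M N A B E V"
  shows "\<exists>C. sum_decomposition M N A B C"
proof -
  let ?J = "index_set N"
  have AM: "A \<in> M" using A by (auto simp: pos_part_def)
  obtain D where D: "D \<in> M" "adj D = D" "D \<star> D = A" using sqrt_exists[OF A] .
  have E: "\<And>j. j \<in> ?J \<Longrightarrow> E j \<in> M" "\<And>j. j \<in> ?J \<Longrightarrow> projection (E j)"
    "\<And>i j. i \<in> ?J \<Longrightarrow> j \<in> ?J \<Longrightarrow> i \<noteq> j \<Longrightarrow> E i \<star> E j = 0"
    and V: "V \<in> M" "partial_isometry V" and rA: "range_proj A \<le>\<^sub>o\<^sub>p adj V \<star> V"
    and eqv: "\<And>j. j \<in> ?J \<Longrightarrow> op_equiv M (E j \<star> V \<star> A \<star> adj V \<star> E j) (B j)"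
    using dc by (auto simp: diagonal_compression_def)
  obtain P where P: "op_sums N E P" "V \<star> adj V \<le>\<^sub>o\<^sub>p P"
    using dc by (auto simp: diagonal_compression_def)
  have Vpi: "V \<star> (adj V \<star> V) = V" and VV: "projection (adj V \<star> V)"
    using V partial_isometry_comp[of V] by (auto simp: partial_isometry_def)
  have adjE: "adj (E j) = E j" "E j \<star> E j = E j" if "j \<in> ?J" for j using E(2)[OF that] by (auto simp: projection_def)
  \<comment> \<open>P is known only as a strong sum. Its complex linearity and self-adjointness are
    read off from the inequality V V^* \<le> P; idempotence then follows from E_i P = E_i.\<close>
  define Q where "Q = P - V \<star> adj V"
  have "Q \<in> bounded_ops" "adj Q = Q" using P(2) by (auto simp: op_le_def positive_op_def Q_def)
  moreover have "P = Q + V \<star> adj V" by (simp add: Q_def)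
  ultimately have Pb: "P \<in> bounded_ops" "adj P = P" using V(1) by simp_all
  have EP: "E i \<star> P = E i" if "i \<in> ?J" for i
    using op_sums_single[OF op_sums_comp_left[OF P(1), of "E i"] that] E(3) adjE(2) that by metis
  have "P \<star> P = P"
  proof (rule op_sums_unique[OF _ P(1)])
    show "op_sums N E (P \<star> P)"
      using op_sums_comp_right[OF P(1), of P] op_sums_cong[of N "\<lambda>j. E j \<star> P" E] EP by simp
  qed
  then have Pp: "projection P" using Pb by (simp add: projection_def)
  have "P \<star> (V \<star> adj V) = V \<star> adj V"
    using projection_le_imp_comp(1)[OF _ Pp P(2)] V(1) Vpi by (simp add: projection_comp_adj)
  then have PV: "P \<star> V = V" using Vpi by (metis comp_assoc)
  have "adj V \<star> V \<star> range_proj A = range_proj A"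
    using projection_le_imp_comp(1)[OF _ VV rA] AM by (simp add: projection_range_proj)
  then have VA: "adj V \<star> V \<star> A = A" using range_proj_comp[of A] AM by (metis M_bounded comp_assoc)
  have VD: "adj V \<star> V \<star> D = D"
    by (rule comp_eq_of_comp_square) (use VA D V VV in \<open>auto simp: projection_def\<close>)
  define X where "X j = D \<star> adj V \<star> E j" for j
  define C where "C j = X j \<star> adj (X j)" for j
  have XM: "X j \<in> M" if "j \<in> ?J" for j using D V E(1)[OF that] by (simp add: X_def)
  have adjX: "adj (X j) = E j \<star> V \<star> D" if "j \<in> ?J" for j
    using D V E(1)[OF that] adjE[OF that] by (simp add: X_def comp_assoc)
  have Ceq: "C j = D \<star> adj V \<star> (E j \<star> (V \<star> D))" if "j \<in> ?J" for j
    unfolding C_def adjX[OF that] by (simp add: X_def comp_assoc comp_reassoc[OF adjE(2)[OF that]])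
  have "op_equiv M (C j) (B j)" if j: "j \<in> ?J" for j
  proof -
    obtain Z where Z: "Z \<in> M" "E j \<star> V \<star> A \<star> adj V \<star> E j = Z \<star> adj Z" "B j = adj Z \<star> Z"
      using eqv[OF j] by (auto simp: op_equiv_def)
    have XX: "adj (X j) \<star> X j = Z \<star> adj Z"
      unfolding Z(2)[symmetric] adjX[OF j] D(3)[symmetric] by (simp add: X_def comp_assoc)
    \<comment> \<open>Transitivity of the equivalence: from X^* X = Z Z^* the operator U carries Z^*
      to X, so C_j = U Z^* Z U^* = U B_j U^*. As the range of B_j lies in that of Z^*, U^* U fixes
      its root b, and U b is the witness.\<close>
    obtain U where U: "U \<in> M" "U \<star> adj Z = X j" "adj U \<star> U = range_proj (adj Z)"
      by (rule partial_isometry_exists[of "X j" "adj Z"]) (use XM[OF j] Z(1) XX in auto)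
    obtain b where b: "b \<in> M" "adj b = b" "b \<star> b = B j" using sqrt_exists[OF B[OF j]] .
    have rZ: "projection (range_proj (adj Z))" "range_proj (adj Z) \<star> adj Z = adj Z"
      using Z(1) by (simp_all add: range_proj)
    have "range_proj (adj Z) \<star> (b \<star> b) = b \<star> b"
      unfolding b(3) Z(3) using comp_reassoc[OF rZ(2), of Z] .
    then have rb: "range_proj (adj Z) \<star> b = b"
      by (rule comp_eq_of_comp_square[rotated -1]) (use b rZ in \<open>auto simp: projection_def\<close>)
    show ?thesis unfolding op_equiv_def
    proof (rule bexI[of _ "U \<star> b"], intro conjI)
      have "C j = (U \<star> adj Z) \<star> adj (U \<star> adj Z)" by (simp add: C_def U(2))
      also have "\<dots> = U \<star> (adj Z \<star> Z) \<star> adj U" using U(1) Z(1) by (simp add: comp_assoc)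
      also have "\<dots> = U \<star> (b \<star> b) \<star> adj U" by (simp add: b(3) Z(3))
      also have "\<dots> = U \<star> b \<star> adj (U \<star> b)" using U(1) b(1,2) by (simp add: comp_assoc)
      finally show "C j = U \<star> b \<star> adj (U \<star> b)" .
      have "adj (U \<star> b) \<star> (U \<star> b) = b \<star> (adj U \<star> U \<star> b)" using U(1) b(1,2) by (simp add: comp_assoc)
      then show "B j = adj (U \<star> b) \<star> (U \<star> b)" by (simp add: U(3) rb b(3))
    qed (use U b in simp)
  qed
  moreover have "C j \<in> pos_part M" if "j \<in> ?J" for j
    using XM[OF that] positive_comp_adj[of "X j"] by (simp add: C_def pos_part_def)
  moreover have "op_sums N C A"
  proof -
    have "op_sums N (\<lambda>j. D \<star> adj V \<star> (E j \<star> (V \<star> D))) (D \<star> adj V \<star> (P \<star> (V \<star> D)))"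
      by (intro op_sums_comp_left op_sums_comp_right P)
    moreover have "D \<star> adj V \<star> (P \<star> (V \<star> D)) = A"
      using VD D by (simp add: comp_assoc comp_reassoc[OF PV])
    ultimately show ?thesis using op_sums_cong[of N C] Ceq by simp
  qed
  ultimately show ?thesis unfolding sum_decomposition_def by blast
qed

text \<open>W_n = T^n S: common powers of T cancel, and then S^* S = I or S^* T = 0 decides.\<close>

lemma properly_infinite_isometry_sequence:
  assumes "properly_infinite M"
  obtains W :: "nat \<Rightarrow> 'a op" where "\<forall>j. W j \<in> M" "\<forall>i j. adj (W i) \<star> W j = (if i = j then id_blinfun else 0)"
proof -
  obtain S T where ST: "S \<in> M" "T \<in> M" "adj S \<star> S = id_blinfun" "adj T \<star> T = id_blinfun" "adj S \<star> T = 0"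
    by (rule properly_infinite_orthogonal_isometries[OF assms])
  have TS: "adj T \<star> S = 0"
  proof -
    have "adj (adj S \<star> T) = 0" using ST by simp
    then show ?thesis using ST(1,2) by simp
  qed
  define W where "W = rec_nat S (\<lambda>_ Y. T \<star> Y)"
  have W0: "W 0 = S" and WS: "W (Suc n) = T \<star> W n" for n by (simp_all add: W_def)
  have WM: "W n \<in> M" for n by (induction n) (use ST in \<open>auto simp: W0 WS\<close>)
  have "adj (W i) \<star> W j = (if i = j then id_blinfun else 0)" for i j
  proof (induction i arbitrary: j)
    case 0
    show ?case by (cases j) (simp_all add: W0 WS ST comp_reassoc[OF ST(5)])
  next
    case (Suc i)
    show ?case
    proof (cases j)
      case 0
      then show ?thesis using WM[of i] ST(2) by (simp add: W0 WS comp_assoc TS)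
    next
      case (Suc k)
      then show ?thesis using WM[of i] ST(2) Suc.IH[of k] by (simp add: WS comp_assoc comp_reassoc[OF ST(4)])
    qed
  qed
  then show thesis using that WM by blast
qed

lemma sum_imp_diagonal_compression:
  assumes inf: "properly_infinite M" and A: "A \<in> pos_part M" and B: "\<And>j. j \<in> index_set N \<Longrightarrow> B j \<in> pos_part M"
    and sd: "sum_decomposition M N A B C"
  shows "\<exists>E V. diagonal_compression M N A B E V"
proof -
  have AM: "A \<in> M" using A by (auto simp: pos_part_def)
  obtain W :: "nat \<Rightarrow> 'a op" where W: "\<forall>j. W j \<in> M" "\<forall>i j. adj (W i) \<star> W j = (if i = j then id_blinfun else 0)"
    by (rule properly_infinite_isometry_sequence[OF inf])
  have WM: "W j \<in> M" and WW: "adj (W i) \<star> W j = (if i = j then id_blinfun else 0)" for i j using W by auto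
  obtain V P where V: "V \<in> M" "adj V \<star> V = range_proj A" and P: "projection P" "op_sums N (\<lambda>j. W j \<star> adj (W j)) P" "P \<star> V = V"
    and VB: "\<forall>j\<in>index_set N. W j \<star> adj (W j) \<star> V \<star> A \<star> adj V \<star> W j \<star> adj (W j) = W j \<star> B j \<star> adj (W j)"
    by (rule compression_of_sum[OF A sd, of W]) (use WM WW in auto)
  have pV: "projection (adj V \<star> V)" using V AM by (simp add: projection_range_proj)
  then have Vpi: "V \<star> (adj V \<star> V) = V" using V by (intro partial_isometry_comp) auto
  have "diagonal_compression M N A B (\<lambda>j. W j \<star> adj (W j)) V"
    unfolding diagonal_compression_def
  proof (intro conjI ballI impI exI[of _ P])
    fix i j assume ij: "j \<in> index_set N"
    show "W j \<star> adj (W j) \<in> M" using WM by simp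
    show "projection (W j \<star> adj (W j))" using WM WW by (intro projection_comp_adj) auto
    show "W i \<star> adj (W i) \<star> (W j \<star> adj (W j)) = 0" if "i \<noteq> j"
      using that by (simp add: comp_assoc comp_reassoc[OF WW])
    show "op_equiv M (W j \<star> adj (W j) \<star> V \<star> A \<star> adj V \<star> (W j \<star> adj (W j))) (B j)"
      using op_equiv_conjugate[OF B[OF ij] WM[of j]] WW[of j j] VB ij by (simp add: comp_assoc)
  next
    show "V \<star> adj V \<le>\<^sub>o\<^sub>p P"
      using V(1) Vpi P(1) by (simp add: projection_le_iff projection_comp_adj comp_reassoc[OF P(3)])
    show "partial_isometry V" using V(1) pV by (simp add: partial_isometry_def)
    show "range_proj A \<le>\<^sub>o\<^sub>p adj V \<star> V" by (simp add: V(2) op_le_refl)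
  qed (use V P in auto)
  then show ?thesis by blast
qed

lemma sum_imp_diagonal_compression_id:
  assumes inf: "properly_infinite M" and N: "1 \<le> N"
    and A: "A \<in> pos_part M" and B: "\<And>j. j \<in> index_set N \<Longrightarrow> B j \<in> pos_part M"
    and sd: "sum_decomposition M N A B C" and NA: "op_equiv M (null_proj A) id_blinfun"
  shows "\<exists>E. diagonal_compression M N A B E id_blinfun"
proof -
  have AM: "A \<in> M" "adj A = A" using A by (auto simp: pos_part_def positive_op_def)
  obtain W :: "nat \<Rightarrow> 'a op" where W: "\<forall>j. W j \<in> M" "\<forall>i j. adj (W i) \<star> W j = (if i = j then id_blinfun else 0)"
    by (rule properly_infinite_isometry_sequence[OF inf])
  have WM: "W j \<in> M" and WW: "adj (W i) \<star> W j = (if i = j then id_blinfun else 0)" for i j using W by auto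
  obtain V P where V: "V \<in> M" "adj V \<star> V = range_proj A"
    and P: "P \<in> M" "projection P" "op_sums N (\<lambda>j. W j \<star> adj (W j)) P" "P \<star> V = V"
      "\<forall>j\<in>index_set N. P \<star> W j = W j" "\<forall>k. k \<notin> index_set N \<longrightarrow> adj (W k) \<star> P = 0"
    and VB: "\<forall>j\<in>index_set N. W j \<star> adj (W j) \<star> V \<star> A \<star> adj V \<star> W j \<star> adj (W j) = W j \<star> B j \<star> adj (W j)"
    by (rule compression_of_sum[OF A sd, of W]) (use WM WW in auto)
  have adjP: "adj P = P" "P \<star> P = P" using P(2) by (auto simp: projection_def)
  have rA: "projection (range_proj A)" "range_proj A \<star> A = A" "range_proj A \<in> M"
    using AM by (simp_all add: range_proj range_proj_in_M)
  have Vpi: "V \<star> range_proj A = V"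
    using partial_isometry_comp[of V] V rA by simp
  \<comment> \<open>N_A = I - R_A, so the assumption N_A \<sim> I provides an isometry whose range
    is the kernel of A.\<close>
  obtain S where S: "S \<in> M" "id_blinfun - range_proj A = S \<star> adj S" "adj S \<star> S = id_blinfun"
    using NA AM null_proj_eq[of A] unfolding op_equiv_def by (metis M_bounded)
  have SA: "adj S \<star> A = 0"
  proof -
    have "adj S \<star> A = adj S \<star> (S \<star> adj S) \<star> A" using S(3) by (simp add: comp_assoc comp_reassoc[OF S(3)])
    also have "\<dots> = 0" unfolding S(2)[symmetric] by (simp add: comp_distribs comp_assoc rA)
    finally show ?thesis .
  qed
  have VS: "V \<star> S = 0"
  proof -
    have "V \<star> S = V \<star> (S \<star> adj S) \<star> S" by (simp add: comp_assoc S(3))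
    also have "\<dots> = 0" unfolding S(2)[symmetric] by (simp add: comp_distribs Vpi)
    finally show ?thesis .
  qed
  \<comment> \<open>Indices start at 1, so W 0 is orthogonal to P and hence to the range of V; this
    is the room needed by \<open>isometry_onto_complement\<close>.\<close>
  have W0V: "adj (W 0) \<star> (V \<star> adj V) = 0"
  proof -
    have "adj (W 0) \<star> P = 0" using P(6) by (simp add: index_set_def)
    from comp_reassoc[OF this, of "V \<star> adj V"] show ?thesis by (simp add: comp_reassoc[OF P(4)])
  qed
  have pVV: "projection (V \<star> adj V)"
    using V Vpi by (intro projection_comp_adj) auto
  obtain T where T: "T \<in> M" "adj T \<star> T = id_blinfun" "T \<star> adj T = id_blinfun - V \<star> adj V"
    by (rule isometry_onto_complement[of "W 0" "V \<star> adj V"]) (use WM WW V pVV W0V in auto)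
  have VT: "adj V \<star> T = 0"
  proof -
    have "adj V \<star> T = adj V \<star> (T \<star> adj T) \<star> T" by (simp add: comp_assoc T(2))
    also have "adj V \<star> (T \<star> adj T) = 0"
    proof -
      have "adj (V \<star> range_proj A) = adj V" using Vpi by simp
      then have "range_proj A \<star> adj V = adj V" using V(1) rA by (simp add: projection_def)
      then show ?thesis unfolding T(3) by (simp add: comp_distribs comp_reassoc[OF V(2)])
    qed
    finally show ?thesis by simp
  qed
  have TV: "adj T \<star> V = 0"
  proof -
    have "adj (adj V \<star> T) = 0" using VT by simp
    then show ?thesis using V(1) T(1) by simp
  qed
  have SV: "adj S \<star> adj V = 0"
  proof -
    have "adj (V \<star> S) = 0" using VS by simp
    then show ?thesis using V(1) S(1) by simp
  qed
  \<comment> \<open>U is V on the closed range of A, and on the kernel it maps through S^* and then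
    T onto the complement of the range of V.\<close>
  define U where "U = V + T \<star> adj S"
  have UM: "U \<in> M" using V T S by (simp add: U_def)
  have adjU: "adj U = adj V + S \<star> adj T" using V(1) T(1) S(1) by (simp add: U_def)
  have U1: "adj U \<star> U = id_blinfun"
  proof -
    have "adj U \<star> U = range_proj A + S \<star> adj S"
      unfolding adjU unfolding U_def
      by (simp add: comp_distribs comp_assoc V(2) comp_reassoc[OF VT] TV comp_reassoc[OF T(2)])
    then show ?thesis by (simp add: S(2)[symmetric])
  qed
  have U2: "U \<star> adj U = id_blinfun"
  proof -
    have "U \<star> adj U = V \<star> adj V + T \<star> adj T"
      unfolding adjU unfolding U_def
      by (simp add: comp_distribs comp_assoc SV comp_reassoc[OF VS] comp_reassoc[OF S(3)])
    then show ?thesis by (simp add: T(3))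
  qed
  have UA: "U \<star> A \<star> adj U = V \<star> A \<star> adj V"
  proof -
    have "U \<star> A = V \<star> A" by (simp add: U_def comp_distribs comp_assoc SA)
    moreover have "A \<star> adj U = A \<star> adj V"
    proof -
      have "adj (adj S \<star> A) = 0" using SA by simp
      then have "A \<star> S = 0" using S(1) AM by simp
      then show ?thesis by (simp add: adjU comp_distribs comp_reassoc)
    qed
    ultimately show ?thesis by (simp add: comp_assoc)
  qed
  have one: "1 \<in> index_set N" using N by (simp add: index_set_def one_enat_def)
  \<comment> \<open>With V = I the projections must sum to the identity, so the remainder I - P is
    added to the first entry, which exists as N \<ge> 1. The compressions are unaffected because (I
    - P) V = 0.\<close>
  define F where "F j = (if j = 1 then W j \<star> adj (W j) + (id_blinfun - P) else W j \<star> adj (W j))" for j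
  have FM: "F j \<in> M" for j using WM P(1) by (simp add: F_def)
  have WP: "adj (W j) \<star> P = adj (W j)" if "j \<in> index_set N" for j
  proof -
    have "adj (P \<star> W j) = adj (W j)" using P(5) that by simp
    then show ?thesis using P(1) WM[of j] adjP by simp
  qed
  have F: "F i \<star> F j = (if i = j then F j else 0)" if "i \<in> index_set N" "j \<in> index_set N" for i j
  proof -
    have PW: "P \<star> W i = W i" "P \<star> W j = W j" "P \<star> W (Suc 0) = W (Suc 0)" using P(5) that one by auto
    show ?thesis
      by (auto simp: F_def comp_distribs comp_assoc comp_reassoc[OF WW] comp_reassoc[OF PW(1)] comp_reassoc[OF PW(2)]
          comp_reassoc[OF PW(3)] WP[OF that(1)] WP[OF that(2)] WP[OF one, simplified] adjP)
  qed
  have adjF: "adj (F j) = F j" for j using WM P(1) by (simp add: F_def adjP)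
  have FV: "F j \<star> V = W j \<star> adj (W j) \<star> V" for j
    by (simp add: F_def comp_distribs P(4))
  have VF: "adj V \<star> F j = adj V \<star> (W j \<star> adj (W j))" for j
  proof -
    have "adj (F j \<star> V) = adj (W j \<star> adj (W j) \<star> V)" using FV by simp
    then show ?thesis using V(1) FM[of j] WM[of j] by (simp add: adjF)
  qed
  define E where "E j = adj U \<star> F j \<star> U" for j
  have EE: "E i \<star> E j = adj U \<star> (F i \<star> F j) \<star> U" for i j
    by (simp add: E_def comp_assoc comp_reassoc[OF U2])
  have "diagonal_compression M N A B E id_blinfun"
    unfolding diagonal_compression_def
  proof (intro conjI ballI impI exI[of _ id_blinfun])
    fix i j assume j: "j \<in> index_set N"
    show "E j \<in> M" using UM FM by (simp add: E_def)
    show "projection (E j)"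
      using UM FM[of j] EE[of j j] F[OF j j] by (simp add: projection_def) (simp add: E_def adjF comp_assoc)
    show "E i \<star> E j = 0" if "i \<in> index_set N" "i \<noteq> j"
      using EE[of i j] F[OF that(1) j] that(2) by simp
    have "E j \<star> A \<star> E j = adj U \<star> F j \<star> (U \<star> A \<star> adj U) \<star> F j \<star> U" by (simp add: E_def comp_assoc)
    also have "\<dots> = adj U \<star> (F j \<star> V) \<star> A \<star> (adj V \<star> F j) \<star> U" unfolding UA by (simp add: comp_assoc)
    also have "\<dots> = adj U \<star> (W j \<star> adj (W j) \<star> V \<star> A \<star> adj V \<star> W j \<star> adj (W j)) \<star> U"
      unfolding FV VF by (simp add: comp_assoc)
    also have "\<dots> = (adj U \<star> W j) \<star> B j \<star> adj (adj U \<star> W j)"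
      using VB j UM WM[of j] by (simp add: comp_assoc)
    finally have eq: "E j \<star> A \<star> E j = (adj U \<star> W j) \<star> B j \<star> adj (adj U \<star> W j)" .
    have "op_equiv M (E j \<star> A \<star> E j) (B j)"
      unfolding eq
    proof (rule op_equiv_conjugate[OF B[OF j]])
      show "adj (adj U \<star> W j) \<star> (adj U \<star> W j) = id_blinfun"
        using UM WM[of j] WW[of j j] by (simp add: comp_assoc comp_reassoc[OF U2])
    qed (use UM WM in simp)
    then show "op_equiv M (E j \<star> id_blinfun \<star> A \<star> adj id_blinfun \<star> E j) (B j)" by simp
  next
    have "op_sums N F (P + (id_blinfun - P))"
      using op_sums_add_at[OF P(3) one, of "id_blinfun - P"] unfolding F_def .
    then have "op_sums N E (adj U \<star> id_blinfun \<star> U)"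
      unfolding E_def by (intro op_sums_comp_left op_sums_comp_right) simp
    then show "op_sums N E id_blinfun" by (simp add: U1)
    show "range_proj A \<le>\<^sub>o\<^sub>p adj id_blinfun \<star> id_blinfun"
      using rA(1) by (simp add: projection_le_iff) (simp add: projection_def projection_le_iff)
  qed (simp_all add: partial_isometry_def projection_def op_le_refl)
  then show ?thesis by blast
qed

end

theorem proposition3p5:
  fixes M :: "'a::chilbert_space op set"
    and A :: "'a op" and B :: "nat \<Rightarrow> 'a op" and N :: enat
  assumes "von_neumann_algebra M"
    and "properly_infinite M"
    and "1 \<le> N"
    and "A \<in> pos_part M"
    and "\<And>j. j \<in> index_set N \<Longrightarrow> B j \<in> pos_part M"
  shows "((\<exists>C. sum_decomposition M N A B C) \<longleftrightarrow> (\<exists>E V. diagonal_compression M N A B E V)) \<and>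
         (op_equiv M (null_proj A) id_blinfun \<longrightarrow>
           (\<exists>E V. diagonal_compression M N A B E V) \<longrightarrow>
           (\<exists>E. diagonal_compression M N A B E id_blinfun))"
proof -
  interpret von_neumann M by standard fact
  have "(\<exists>C. sum_decomposition M N A B C)" if "diagonal_compression M N A B E V" for E V
    using diagonal_compression_imp_sum[OF assms(4) assms(5) that] .
  moreover have "\<exists>E V. diagonal_compression M N A B E V" if "sum_decomposition M N A B C" for C
    using sum_imp_diagonal_compression[OF assms(2) assms(4) assms(5) that] .
  \<comment> \<open>This starts from a sum decomposition; the compression with general V assumed in
    the last claim supplies one by the first implication.\<close>
  moreover have "\<exists>E. diagonal_compression M N A B E id_blinfun"
    if "sum_decomposition M N A B C" "op_equiv M (null_proj A) id_blinfun" for C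
    using sum_imp_diagonal_compression_id[OF assms(2,3,4) assms(5) that] .
  ultimately show ?thesis by blast
qed

end
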